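(* Let $n,p,q,j$ be integers with $p,q\ge 1$, $0\le n\le pq$, and $j\ge 0$. 1. If $j>pq-n$, then $H_j[C(n;p,q)]=0$. 2. If $j>n$, then $H_j[C(n;p,q)]=0$. 3. If $j>pq/3$, then $H_j[C(n;p,q)]=0$. Equivalently, setting $x=n/(pq)$ and $y=j/(pq)$, if $H_j[C(n;p,q)]\neq 0$ then $y\le \min\{1-x,\;x,\;1/3\}$.
   Context: $C(n;p,q)$ is the ordered configuration space of $n$ unit squares in a $p\times q$ rectangle. It is the subspace of $\mathbb{R}^{2n}$ of all points $(x_1,y_1,\dots,x_n,y_n)$ such that $1\le x_k\le p$ and $1\le y_k\le q$ for all $1\le k\le n$, and such that $|x_k-x_\ell|\ge 1$ or $|y_k-y_\ell|\ge 1$ for all $1\le k<\ell\le n$. $H_j$ denotes singular homology with integer coefficients. *)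

theory Defs
  imports "HOL-Homology.Homology"
begin

text \<open>
  The centres \<open>(x\<^sub>1, y\<^sub>1, \<dots>, x\<^sub>n, y\<^sub>n)\<close> form a point \<open>v\<close> of
  \<^term>\<open>Euclidean_space (2 * n)\<close>, whose coordinates are numbered from \<open>0\<close>. Counting squares from
  \<open>0\<close> as well, square \<open>k < n\<close> has its centre at \<open>(v (2 * k), v (2 * k + 1))\<close>.
\<close>

definition square_config_space :: "nat \<Rightarrow> nat \<Rightarrow> nat \<Rightarrow> (nat \<Rightarrow> real) topology" where
  "square_config_space n p q =
     subtopology (Euclidean_space (2 * n))
       {v. (\<forall>k<n. 1 \<le> v (2 * k) \<and> v (2 * k) \<le> real p \<and>
                  1 \<le> v (2 * k + 1) \<and> v (2 * k + 1) \<le> real q) \<and>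
           (\<forall>k l. k < l \<and> l < n \<longrightarrow>
                  \<bar>v (2 * k) - v (2 * l)\<bar> \<ge> 1 \<or> \<bar>v (2 * k + 1) - v (2 * l + 1)\<bar> \<ge> 1)}"

end

theory Submission
  imports Defs
begin

text \<open>
  A monotone staircase function, applied to all coordinates, is homotopic to the identity and pushes
  the configuration space into its largest subcomplex of unit grid cubes: along the homotopy,
  coordinates at distance at least 1 stay at distance at least 1. So it suffices to treat this
  cubical complex \<open>X\<close>, for whose subcomplexes the same staircase yields Mayer-Vietoris arguments.

  A cell of \<open>X\<close> is given by its lowest corner, which places the \<open>n\<close> squares on distinct cells of the
  \<open>p \<times> q\<close> board, and by a set of moves: each square may be widened to the right, heightened
  upwards, or both. Adding the cells corner by corner, in order of decreasing coordinate sum,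
  attaches for each corner the independence complex of a graph of admissible moves. This graph
  is a union of paths along the antidiagonals, and folding it at leaves shows that its independence
  complex contributes homology only in a degree \<open>s\<close>, where each of the \<open>s\<close> folding steps uses up a
  free cell of the board, two moves, and three cells of the board. There are only \<open>p q - n\<close>,
  \<open>2 n\<close> and \<open>p q\<close> of these, respectively.
\<close>

text \<open>The degree \<open>j\<close> is fixed, and the argument is discrete Morse theory in
  disguise. Adding a cell of dimension below \<open>j\<close> cannot create homology in degree
  \<open>j\<close>, and adding a cell together with a facet that is free in the enlarged complex
  changes nothing. So the cells over one corner are to be matched in such pairs, leaving at most one
  cell over, whose dimension is the number of folds; everything then depends on bounding that number
  below \<open>j\<close>. The matching exists for two reasons. Collisions between expanded squares
  are already caused by two moves, so the cells over a corner form a flag complex, in which the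
  empty set stands for the corner itself. And the conflict graph has at most two neighbours per
  vertex and no cycles, so a leaf or an isolated vertex is always available. In degree 1 the
  intersections that occur are nonempty and have nontrivial homology in degree 0, so the gluing
  steps fill given boundaries instead of asking for a vanishing group.\<close>

section \<open>Vanishing of singular homology groups\<close>

lemma trivial_homology_group_iff:
  "trivial_group (homology_group (int p) X) \<longleftrightarrow>
   (\<forall>c. singular_relcycle p X {} c \<longrightarrow> singular_relboundary p X {} c)" (is "?L \<longleftrightarrow> ?R")
proof -
  have 1: "?L \<longleftrightarrow> homologous_rel_set p X {} ` singular_relcycle_set p X {} = {singular_relboundary_set p X {}}"
    unfolding trivial_group_def carrier_relative_homology_group one_relative_homology_group
    by simp
  have "singular_relcycle p X {} 0" by simp
  then have "singular_relcycle_set p X {} \<noteq> {}" by blast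
  moreover have "f ` Z = {b} \<longleftrightarrow> (\<forall>c\<in>Z. f c = b)" if "Z \<noteq> {}" for f :: "'a chain \<Rightarrow> 'a chain set" and Z b
    using that by blast
  ultimately show ?thesis
    unfolding 1 by (simp add: homologous_rel_set_eq_relboundary)
qed

lemma trivial_homology_group_contractible_space:
  assumes "contractible_space X" "j \<ge> 1"
  shows "trivial_group (homology_group (int j) X)"
  using trivial_reduced_homology_group_contractible_space[OF assms(1), of "int j"] assms(2)
  by (simp add: un_reduced_homology_group)

text \<open>Up to homotopy the identity of \<open>X\<close> factors through \<open>S\<close>, so
  every cycle is homologous to one lying in \<open>S\<close>, and that one bounds there.\<close>

lemma trivial_homology_group_homotopic_factor:
  assumes hom: "homotopic_with (\<lambda>_. True) X X id g"
    and g: "g ` topspace X \<subseteq> S"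
    and S: "trivial_group (homology_group (int j) (subtopology X S))"
  shows "trivial_group (homology_group (int j) X)"
  unfolding trivial_homology_group_iff
proof (intro allI impI)
  fix c assume c: "singular_relcycle j X {} c"
  then have cc: "singular_chain j X c"
    by (simp add: singular_cycle)
  have "homologous_rel j X {} (chain_map j id c) (chain_map j g c)"
    using hom c by (intro homotopic_imp_homologous_rel_chain_maps[where S = X and T = "{}"]) auto
  then have 1: "singular_relboundary j X {} (c - chain_map j g c)"
    unfolding chain_map_ident[OF cc] homologous_rel_def .
  have "continuous_map X (subtopology X S) g"
    using homotopic_with_imp_continuous_maps[OF hom] g by (auto simp: continuous_map_in_subtopology)
  then have "singular_relcycle j (subtopology X S) {} (chain_map j g c)"
    using c by (auto intro: singular_relcycle_chain_map)
  then have "singular_relboundary j (subtopology X S) {} (chain_map j g c)"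
    using S by (simp add: trivial_homology_group_iff)
  then have "singular_relboundary j X {} (chain_map j g c)"
    using singular_boundary_mono[of S UNIV j X] by auto
  from singular_relboundary_add[OF 1 this] show "singular_relboundary j X {} c"
    by simp
qed

text \<open>The contraction makes the boundary of \<open>z\<close> homologous to its image under a
  constant map, which is the boundary of the constant image of \<open>z\<close>. This covers
  \<open>j = 1\<close> too, where only the reduced homology of a nonempty contractible space
  vanishes.\<close>

lemma boundary_bounds_in_contractible:
  assumes con: "contractible_space (subtopology X S)"
    and j: "j \<ge> 1"
    and z: "singular_chain j X z"
    and dz: "singular_chain (j - 1) (subtopology X S) (chain_boundary j z)"
  shows "\<exists>d. singular_chain j (subtopology X S) d \<and> chain_boundary j d = chain_boundary j z"
proof (cases "topspace X \<inter> S = {}")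
  case True
  then have "chain_boundary j z = 0"
    using dz singular_chain_empty[of "subtopology X S"] by simp
  then show ?thesis
    by (intro exI[of _ 0]) simp
next
  case False
  let ?Y = "subtopology X S"
  obtain s where hom: "homotopic_with (\<lambda>_. True) ?Y ?Y id (\<lambda>x. s)"
    using con by (auto simp: contractible_space_def)
  have "s \<in> topspace ?Y"
    using continuous_map_image_subset_topspace[OF conjunct2[OF homotopic_with_imp_continuous_maps[OF hom]]] False
    by auto
  then have s: "s \<in> S" "s \<in> topspace X" by auto
  have cyc: "singular_relcycle (j - 1) ?Y {} (chain_boundary j z)"
    using dz chain_boundary_boundary[OF z] by (simp add: singular_cycle)
  have "homologous_rel (j - 1) ?Y {} (chain_map (j - 1) id (chain_boundary j z))
          (chain_map (j - 1) (\<lambda>x. s) (chain_boundary j z))"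
    using hom cyc by (intro homotopic_imp_homologous_rel_chain_maps[where S = ?Y and T = "{}"]) auto
  moreover have "chain_map (j - 1) (\<lambda>x. s) (chain_boundary j z) = chain_boundary j (chain_map j (\<lambda>x. s) z)"
    using chain_boundary_chain_map[OF z, of "\<lambda>x. s"] by simp
  ultimately have "singular_relboundary (j - 1) ?Y {} (chain_boundary j z - chain_boundary j (chain_map j (\<lambda>x. s) z))"
    unfolding chain_map_ident[OF dz] homologous_rel_def by simp
  then obtain d where d: "singular_chain j ?Y d"
     "chain_boundary j d = chain_boundary j z - chain_boundary j (chain_map j (\<lambda>x. s) z)"
    using j by (auto simp: singular_boundary)
  have "singular_chain j ?Y (chain_map j (\<lambda>x. s) z)"
    using s by (intro singular_chain_chain_map[OF z]) auto
  with d show ?thesis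
    by (intro exI[of _ "d + chain_map j (\<lambda>x. s) z"]) (simp add: singular_chain_add chain_boundary_add)
qed

text \<open>Subdivision splits a cycle into chains in \<open>U\<close> and \<open>W\<close>, and
  \<open>f\<close> carries them into \<open>A\<close> and \<open>B\<close>. Their boundaries agree
  up to sign, lie in \<open>A \<inter> B\<close> and are filled there by \<open>d\<close>;
  correcting both chains by \<open>d\<close> gives cycles of \<open>A\<close> and of
  \<open>B\<close>, which bound. Filling only boundaries of chains of \<open>X\<close> acts as a
  reduced version of vanishing in degree \<open>j - 1\<close>.\<close>

lemma Mayer_Vietoris_vanishing:
  assumes j: "j \<ge> 1"
    and UW: "openin X U" "openin X W" "topspace X \<subseteq> U \<union> W"
    and hom: "homotopic_with (\<lambda>_. True) X X id f"
    and f: "f ` U \<subseteq> A" "f ` W \<subseteq> B"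
    and A: "trivial_group (homology_group (int j) (subtopology X A))"
    and B: "trivial_group (homology_group (int j) (subtopology X B))"
    and AB: "\<And>z. \<lbrakk>singular_chain j X z;
                   singular_chain (j - 1) (subtopology X (A \<inter> B)) (chain_boundary j z)\<rbrakk> \<Longrightarrow>
               \<exists>d. singular_chain j (subtopology X (A \<inter> B)) d \<and> chain_boundary j d = chain_boundary j z"
  shows "trivial_group (homology_group (int j) X)"
  unfolding trivial_homology_group_iff
proof (intro allI impI)
  fix c assume c: "singular_relcycle j X {} c"
  obtain c' where c': "singular_relcycle j X {} c'" "homologous_rel j X {} c c'"
    and small: "\<And>f. f \<in> Poly_Mapping.keys c' \<Longrightarrow> \<exists>V \<in> {U, W}. f \<in> (standard_simplex j) \<rightarrow> V"
    using small_homologous_rel_relcycle_exists[of "{U,W}" X j "{}" c] UW c by auto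
  have cc': "singular_chain j X c'" "chain_boundary j c' = 0"
    using c' by (auto simp: singular_cycle)
  have "Poly_Mapping.keys c' \<subseteq> singular_simplex_set j (subtopology X U) \<union> singular_simplex_set j (subtopology X W)"
    using small cc'(1) by (fastforce simp: singular_chain_def singular_simplex_subtopology)
  then obtain c1 c2 where "Poly_Mapping.keys c1 \<subseteq> singular_simplex_set j (subtopology X U)"
      "Poly_Mapping.keys c2 \<subseteq> singular_simplex_set j (subtopology X W)" and sum: "c1 + c2 = c'"
    by (rule frag_split)
  then have c1: "singular_chain j (subtopology X U) c1" and c2: "singular_chain j (subtopology X W) c2"
    by (simp_all add: singular_chain_def)
  have contf: "continuous_map X X f"
    using homotopic_with_imp_continuous_maps[OF hom] by blast
  have fU: "continuous_map (subtopology X U) (subtopology X A) f"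
    using contf f by (auto simp: continuous_map_in_subtopology continuous_map_from_subtopology)
  have fW: "continuous_map (subtopology X W) (subtopology X B) f"
    using contf f by (auto simp: continuous_map_in_subtopology continuous_map_from_subtopology)
  let ?f1 = "chain_map j f c1" and ?f2 = "chain_map j f c2"
  have f1: "singular_chain j (subtopology X A) ?f1"
    using c1 fU by (rule singular_chain_chain_map)
  have f2: "singular_chain j (subtopology X B) ?f2"
    using c2 fW by (rule singular_chain_chain_map)
  have "chain_boundary j (chain_map j f c') = 0"
    using chain_boundary_chain_map[OF cc'(1), of f] cc'(2) by simp
  then have bd: "chain_boundary j ?f1 = - chain_boundary j ?f2"
    by (simp add: sum[symmetric] chain_map_add chain_boundary_add eq_neg_iff_add_eq_0)
  have "singular_chain (j - 1) (subtopology X A) (chain_boundary j ?f1)"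
    using singular_chain_boundary[OF f1] by simp
  moreover have "singular_chain (j - 1) (subtopology X B) (chain_boundary j ?f1)"
    unfolding bd using singular_chain_boundary[OF f2] by (simp add: singular_chain_minus)
  ultimately have "singular_chain (j - 1) (subtopology X (A \<inter> B)) (chain_boundary j ?f1)"
    by (auto simp: singular_chain_subtopology)
  moreover have "singular_chain j X ?f1"
    using f1 by (simp add: singular_chain_subtopology)
  ultimately obtain d where d: "singular_chain j (subtopology X (A \<inter> B)) d"
       "chain_boundary j d = chain_boundary j ?f1"
    using AB by blast
  have dA: "singular_chain j (subtopology X A) d" and dB: "singular_chain j (subtopology X B) d"
    using d(1) by (auto simp: singular_chain_subtopology)
  have "singular_relcycle j (subtopology X A) {} (?f1 - d)"
    using f1 dA d(2) by (simp add: singular_cycle singular_chain_diff chain_boundary_diff)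
  then have "singular_relboundary j (subtopology X A) {} (?f1 - d)"
    using A by (simp add: trivial_homology_group_iff)
  then have 1: "singular_relboundary j X {} (?f1 - d)"
    using singular_boundary_mono[of A UNIV j X] by auto
  have "singular_relcycle j (subtopology X B) {} (?f2 + d)"
    using f2 dB d(2) bd by (simp add: singular_cycle singular_chain_add chain_boundary_add)
  then have "singular_relboundary j (subtopology X B) {} (?f2 + d)"
    using B by (simp add: trivial_homology_group_iff)
  then have "singular_relboundary j X {} (?f2 + d)"
    using singular_boundary_mono[of B UNIV j X] by auto
  from singular_relboundary_add[OF 1 this]
  have 2: "singular_relboundary j X {} (chain_map j f c')"
    by (simp add: sum[symmetric] chain_map_add)
  have "homologous_rel j X {} (chain_map j id c') (chain_map j f c')"
    using hom c'(1) by (intro homotopic_imp_homologous_rel_chain_maps[where S = X and T = "{}"]) auto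
  then have "singular_relboundary j X {} (c' - chain_map j f c')"
    unfolding chain_map_ident[OF cc'(1)] homologous_rel_def .
  from singular_relboundary_add[OF this 2] have "singular_relboundary j X {} c'" by simp
  with c'(2) have "singular_relboundary j X {} (c - c' + c')"
    unfolding homologous_rel_def by (rule singular_relboundary_add)
  then show "singular_relboundary j X {} c" by simp
qed

section \<open>Straight-line homotopies in the product topology\<close>

lemma continuous_on_coordinate:
  fixes f :: "'a::topological_space \<Rightarrow> nat \<Rightarrow> real"
  assumes "continuous_on S f"
  shows "continuous_on S (\<lambda>x. f x i)"
  using continuous_on_product_then_coordinatewise[OF assms] .

text \<open>The type \<open>nat \<Rightarrow> real\<close> carries the product topology, so joint
  continuity of the homotopy is checked one coordinate at a time.\<close>

lemma homotopic_with_linear_product: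
  fixes f g :: "'a::topological_space \<Rightarrow> nat \<Rightarrow> real"
  assumes "continuous_on S f" "continuous_on S g"
    and "\<And>x t. \<lbrakk>x \<in> S; 0 \<le> t; t \<le> 1\<rbrakk> \<Longrightarrow> (\<lambda>i. (1 - t) * f x i + t * g x i) \<in> T"
  shows "homotopic_with (\<lambda>_. True) (top_of_set S) (top_of_set T) f g"
  unfolding homotopic_with_def
proof (intro exI conjI)
  let ?h = "\<lambda>(t::real, x) i. (1 - t) * f x i + t * g x i"
  have "continuous_on ({0..1} \<times> S) ?h"
  proof (intro continuous_on_coordinatewise_then_product)
    fix i
    have *: "continuous_on ({0..1} \<times> S) (\<lambda>u::real \<times> 'a. f (snd u) i)"
            "continuous_on ({0..1} \<times> S) (\<lambda>u::real \<times> 'a. g (snd u) i)"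
      by (rule continuous_on_compose2[OF continuous_on_coordinate[OF assms(1)] continuous_on_snd[OF continuous_on_id]]
               continuous_on_compose2[OF continuous_on_coordinate[OF assms(2)] continuous_on_snd[OF continuous_on_id]],
          force)+
    show "continuous_on ({0..1} \<times> S) (\<lambda>x. ?h x i)"
      unfolding case_prod_unfold
      by (intro continuous_on_mult continuous_on_add continuous_on_diff continuous_on_const
          continuous_on_fst continuous_on_id *)
  qed
  moreover have "?h \<in> {0..1::real} \<times> S \<rightarrow> T"
  proof
    fix u assume "u \<in> {0..1::real} \<times> S"
    then show "?h u \<in> T"
      using assms(3)[of "snd u" "fst u"] by (simp add: case_prod_unfold mem_Times_iff)
  qed
  ultimately show "continuous_map (prod_topology (top_of_set {0..1}) (top_of_set S)) (top_of_set T) ?h"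
    unfolding prod_topology_subtopology_eu continuous_map_subtopology_eu by blast
qed simp_all

section \<open>Cubical complexes\<close>

text \<open>Summand \<open>i\<close> climbs from 0 to 1 on the interval from
  \<open>i + 1 - (i + 2) / M\<close> to \<open>i + 1 - (i + 1) / M\<close>. If all steps occurred at
  the same place modulo 1, two coordinates at distance 1 could both be inside a step, and the
  product of their unit intervals would contain collisions. Shifting each step by
  \<open>1 / M\<close> against the one below prevents this.\<close>

definition staircase :: "nat \<Rightarrow> real \<Rightarrow> real" where
  "staircase M t = (\<Sum>i<M. min 1 (max 0 (real M * (t - real i - 1) + real i + 2)))"

lemma continuous_on_staircase: "continuous_on S (staircase M)"
  unfolding staircase_def by (intro continuous_intros)

lemma staircase_nonneg: "0 \<le> staircase M t"
  unfolding staircase_def by (intro sum_nonneg) auto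

lemma staircase_ge:
  assumes "m \<le> M" "\<And>i. i < m \<Longrightarrow> real M * (t - real i - 1) + real i + 2 \<ge> 1"
  shows "real m \<le> staircase M t"
proof -
  have "real m = (\<Sum>i<m. 1)" by simp
  also have "\<dots> \<le> (\<Sum>i<m. min 1 (max 0 (real M * (t - real i - 1) + real i + 2)))"
    using assms(2) by (intro sum_mono) fastforce
  also have "\<dots> \<le> staircase M t"
    unfolding staircase_def using assms(1) by (intro sum_mono2) auto
  finally show ?thesis .
qed

lemma staircase_le:
  assumes "m \<le> M" "\<And>i. m \<le> i \<Longrightarrow> i < M \<Longrightarrow> real M * (t - real i - 1) + real i + 2 \<le> 0"
  shows "staircase M t \<le> real m"
proof -
  have "staircase M t = (\<Sum>i<m. min 1 (max 0 (real M * (t - real i - 1) + real i + 2)))"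
    unfolding staircase_def using assms by (intro sum.mono_neutral_right) auto
  also have "\<dots> \<le> (\<Sum>i<m. 1)" by (intro sum_mono) auto
  finally show ?thesis by simp
qed

text \<open>Step \<open>m\<close> starts at \<open>m + 1 - (m + 2) / M\<close>, which is at least
  \<open>m + 1 / M\<close> exactly when \<open>m + 3 \<le> M\<close>. The margin
  \<open>1 / M\<close> around integers later lets open neighbourhoods of cubes be pushed back into
  the cubes.\<close>

lemma staircase_le_nat:
  assumes "m + 3 \<le> M" "t \<le> real m + 1 / real M"
  shows "staircase M t \<le> real m"
proof (rule staircase_le)
  fix i assume i: "m \<le> i" "i < M"
  have "real M * (t - real i - 1) \<le> real M * (real m + 1 / real M - real i - 1)"
    using assms by (intro mult_left_mono) auto
  also have "\<dots> = 1 - real M - real M * (real i - real m)"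
    using assms(1) by (simp add: field_simps)
  also have "\<dots> \<le> 1 - real M - (real i - real m)"
    using i assms(1) mult_right_mono[of 1 "real M" "real i - real m"] by simp
  finally show "real M * (t - real i - 1) + real i + 2 \<le> 0"
    using assms(1) by linarith
qed (use assms in auto)

text \<open>For \<open>m \<ge> 1\<close>, step \<open>m - 1\<close> is complete at
  \<open>m - m / M\<close>, which is at most \<open>m - 1 / M\<close>.\<close>

lemma staircase_ge_nat:
  assumes "m \<le> M" "real m - 1 / real M \<le> t"
  shows "real m \<le> staircase M t"
proof (rule staircase_ge)
  fix i assume i: "i < m"
  have "real M * (real m - 1 / real M - real i - 1) \<le> real M * (t - real i - 1)"
    using assms by (intro mult_left_mono) auto
  moreover have "real M * (real m - 1 / real M - real i - 1) = real M * (real m - real i - 1) - 1"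
    using assms(1) i by (simp add: field_simps)
  moreover have "0 \<le> real M * (real m - real i - 1)"
    using i by (intro mult_nonneg_nonneg) auto
  ultimately show "real M * (t - real i - 1) + real i + 2 \<ge> 1"
    by linarith
qed (use assms in auto)

text \<open>
  The steps of the staircase occur earlier (modulo 1) at higher levels, so of two coordinates
  at distance 1 the larger one has finished its step when the smaller one begins.
\<close>

lemma staircase_separates:
  assumes "real m < staircase M t" "t + 1 \<le> t'" "t \<le> real P" "P + 3 \<le> M"
  shows "real (m + 2) \<le> staircase M t'"
proof -
  \<comment> \<open>The bound \<open>P\<close> gives \<open>m < P\<close>, so that step
    \<open>m + 1\<close> is among the \<open>M\<close> steps.\<close>
  have "staircase M t \<le> real P"
    using assms by (intro staircase_le_nat) (auto intro: order_trans)
  then have m: "m < P" using assms(1) by simp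
  \<comment> \<open>The clamped expressions do not increase with \<open>i\<close>: if step
    \<open>m\<close> had not begun, no later one would have, and the height would be at most
    \<open>m\<close>.\<close>
  have pos: "real M * (t - real m - 1) + real m + 2 > 0"
  proof (rule ccontr)
    assume neg: "\<not> ?thesis"
    have "staircase M t \<le> real m"
    proof (rule staircase_le)
      fix i assume "m \<le> i" "i < M"
      then have "1 * (real i - real m) \<le> real M * (real i - real m)"
        by (intro mult_right_mono) auto
      then show "real M * (t - real i - 1) + real i + 2 \<le> 0"
        using neg by (simp add: algebra_simps)
    qed (use m assms in auto)
    then show False using assms(1) by simp
  qed
  show ?thesis
  proof (rule staircase_ge)
    fix i assume i: "i < m + 2"
    have "1 * (real m + 1 - real i) \<le> real M * (real m + 1 - real i)"
      using i m assms(4) by (intro mult_right_mono) auto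
    moreover have "real M * (t + 1 - real i - 1) \<le> real M * (t' - real i - 1)"
      using assms(2) by (intro mult_left_mono) auto
    ultimately show "real M * (t' - real i - 1) + real i + 2 \<ge> 1"
      using pos by (simp add: algebra_simps)
  qed (use m assms in auto)
qed

section \<open>Cells, faces and realizations\<close>

type_synonym cell = "(nat \<Rightarrow> nat) \<times> nat set"

definition cube :: "cell \<Rightarrow> (nat \<Rightarrow> real) set" where
  "cube \<sigma> = {x. \<forall>i. real (fst \<sigma> i) \<le> x i \<and> x i \<le> real (fst \<sigma> i) + of_bool (i \<in> snd \<sigma>)}"

definition face :: "cell \<Rightarrow> cell \<Rightarrow> bool" where
  "face \<tau> \<sigma> \<longleftrightarrow> (\<forall>i. fst \<sigma> i \<le> fst \<tau> i \<and>
      fst \<tau> i + of_bool (i \<in> snd \<tau>) \<le> fst \<sigma> i + of_bool (i \<in> snd \<sigma>))"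

definition subcomplex :: "cell set \<Rightarrow> bool" where
  "subcomplex K \<longleftrightarrow> (\<forall>\<sigma>\<in>K. \<forall>\<tau>. face \<tau> \<sigma> \<longrightarrow> \<tau> \<in> K)"

definition realization :: "cell set \<Rightarrow> (nat \<Rightarrow> real) set" where
  "realization K = (\<Union>\<sigma>\<in>K. cube \<sigma>)"

text \<open>The cells of the grid in \<open>N\<close> dimensions on which the staircase with \<open>M\<close> steps fixes all
  vertices.\<close>

definition grid_cells :: "nat \<Rightarrow> nat \<Rightarrow> cell set" where
  "grid_cells N M = {\<sigma>. (\<forall>i\<ge>N. fst \<sigma> i = 0 \<and> i \<notin> snd \<sigma>) \<and> (\<forall>i. fst \<sigma> i + of_bool (i \<in> snd \<sigma>) + 3 \<le> M)}"

abbreviation vanishing :: "nat \<Rightarrow> cell set \<Rightarrow> bool" where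
  "vanishing j K \<equiv> trivial_group (homology_group (int j) (top_of_set (realization K)))"

lemma face_refl: "face \<sigma> \<sigma>"
  by (simp add: face_def)

lemma face_trans: "face \<rho> \<tau> \<Longrightarrow> face \<tau> \<sigma> \<Longrightarrow> face \<rho> \<sigma>"
  unfolding face_def by (meson le_trans)

lemma face_subset: "face \<tau> \<sigma> \<Longrightarrow> snd \<tau> \<subseteq> snd \<sigma>"
proof
  fix i assume "face \<tau> \<sigma>" "i \<in> snd \<tau>"
  then have "fst \<sigma> i \<le> fst \<tau> i" "fst \<tau> i + 1 \<le> fst \<sigma> i + of_bool (i \<in> snd \<sigma>)"
    unfolding face_def by (metis of_bool_eq(2))+
  then show "i \<in> snd \<sigma>"
    by (cases "i \<in> snd \<sigma>") auto
qed

lemma face_same_dim: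
  assumes "face \<tau> \<sigma>" "snd \<tau> = snd \<sigma>" shows "\<tau> = \<sigma>"
proof -
  have "fst \<tau> i = fst \<sigma> i" for i
    using assms unfolding face_def by (metis add_le_cancel_right antisym)
  then show ?thesis using assms(2) by (simp add: prod_eq_iff fun_eq_iff)
qed

lemma subcomplexD: "subcomplex K \<Longrightarrow> \<sigma> \<in> K \<Longrightarrow> face \<tau> \<sigma> \<Longrightarrow> \<tau> \<in> K"
  unfolding subcomplex_def by blast

lemma subcomplex_faces: "subcomplex {\<tau>. face \<tau> \<sigma>}"
  unfolding subcomplex_def using face_trans by blast

lemma subcomplex_Int: "subcomplex K \<Longrightarrow> subcomplex L \<Longrightarrow> subcomplex (K \<inter> L)"
  unfolding subcomplex_def by blast

lemma cube_mono: 
  assumes "face \<tau> \<sigma>" shows "cube \<tau> \<subseteq> cube \<sigma>"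
proof
  fix x assume x: "x \<in> cube \<tau>"
  have "real (fst \<sigma> i) \<le> x i \<and> x i \<le> real (fst \<sigma> i) + of_bool (i \<in> snd \<sigma>)" for i
  proof -
    have "real (fst \<sigma> i) \<le> real (fst \<tau> i)"
      using assms by (simp add: face_def)
    moreover have "real (fst \<tau> i + of_bool (i \<in> snd \<tau>)) \<le> real (fst \<sigma> i + of_bool (i \<in> snd \<sigma>))"
      using assms by (simp only: face_def of_nat_le_iff)
    moreover have "real (fst \<tau> i) \<le> x i \<and> x i \<le> real (fst \<tau> i) + of_bool (i \<in> snd \<tau>)"
      using x by (simp add: cube_def)
    ultimately show ?thesis by simp
  qed
  then show "x \<in> cube \<sigma>" by (simp add: cube_def)
qed

lemma realization_faces: "realization {\<tau>. face \<tau> \<sigma>} = cube \<sigma>"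
  unfolding realization_def using cube_mono face_refl by blast

text \<open>For a point with nonnegative coordinates this is the smallest cell whose cube contains
  it.\<close>

definition carrier_cell :: "(nat \<Rightarrow> real) \<Rightarrow> cell" where
  "carrier_cell x = (\<lambda>i. nat \<lfloor>x i\<rfloor>, {i. x i \<notin> \<int>})"

lemma carrier_cell_face:
  assumes "x \<in> cube \<sigma>" shows "face (carrier_cell x) \<sigma>"
  unfolding face_def
proof
  fix i
  have x: "real (fst \<sigma> i) \<le> x i" "x i \<le> real (fst \<sigma> i) + of_bool (i \<in> snd \<sigma>)"
    using assms by (auto simp: cube_def)
  then have "int (fst \<sigma> i) \<le> \<lfloor>x i\<rfloor>" by (simp add: le_floor_iff)
  moreover have "\<lfloor>x i\<rfloor> + of_bool (x i \<notin> \<int>) \<le> int (fst \<sigma> i) + of_bool (i \<in> snd \<sigma>)"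
  proof (cases "x i \<in> \<int>")
    case True
    then show ?thesis using x by (auto elim!: Ints_cases)
  next
    case False
    have "\<lceil>x i\<rceil> \<le> int (fst \<sigma> i) + of_bool (i \<in> snd \<sigma>)"
      using x(2) by (simp add: ceiling_le_iff)
    moreover have "x i \<noteq> of_int \<lfloor>x i\<rfloor>" using False by (metis Ints_of_int)
    ultimately show ?thesis using False by (simp add: ceiling_altdef)
  qed
  ultimately show "fst \<sigma> i \<le> fst (carrier_cell x) i \<and>
      fst (carrier_cell x) i + of_bool (i \<in> snd (carrier_cell x)) \<le> fst \<sigma> i + of_bool (i \<in> snd \<sigma>)"
    by (cases "x i \<in> \<int>"; cases "i \<in> snd \<sigma>") (auto simp: carrier_cell_def)
qed

lemma in_cube_carrier_cell:
  assumes "\<And>i. 0 \<le> x i" shows "x \<in> cube (carrier_cell x)"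
proof -
  have "real (nat \<lfloor>x i\<rfloor>) \<le> x i \<and> x i \<le> real (nat \<lfloor>x i\<rfloor>) + of_bool (x i \<notin> \<int>)" for i
    using assms[of i] by (cases "x i \<in> \<int>") (auto elim!: Ints_cases)
  then show ?thesis by (simp add: cube_def carrier_cell_def)
qed

lemma cube_nonneg: "x \<in> cube \<sigma> \<Longrightarrow> 0 \<le> x i"
  unfolding cube_def by (smt (verit) mem_Collect_eq of_nat_0_le_iff)

text \<open>The carrier of a common point is a face of every cell whose cube contains that point, so
  it belongs to both subcomplexes.\<close>

lemma realization_Int:
  assumes "subcomplex K" "subcomplex L"
  shows "realization (K \<inter> L) = realization K \<inter> realization L"
proof
  show "realization K \<inter> realization L \<subseteq> realization (K \<inter> L)"
  proof
    fix x assume "x \<in> realization K \<inter> realization L"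
    then obtain \<sigma> \<tau> where *: "\<sigma> \<in> K" "x \<in> cube \<sigma>" "\<tau> \<in> L" "x \<in> cube \<tau>"
      by (auto simp: realization_def)
    then have "carrier_cell x \<in> K \<inter> L"
      using assms carrier_cell_face subcomplexD by blast
    moreover have "x \<in> cube (carrier_cell x)"
      using * cube_nonneg in_cube_carrier_cell by blast
    ultimately show "x \<in> realization (K \<inter> L)"
      by (auto simp: realization_def)
  qed
qed (auto simp: realization_def)

lemma realization_Un: "realization (K \<union> L) = realization K \<union> realization L"
  by (auto simp: realization_def)

lemma cube_convex:
  assumes "x \<in> cube \<sigma>" "y \<in> cube \<sigma>" "0 \<le> t" "t \<le> 1"
  shows "(\<lambda>i. (1 - t) * x i + t * y i) \<in> cube \<sigma>"
proof -
  have "(1 - t) * x i + t * y i \<in> {real (fst \<sigma> i)..real (fst \<sigma> i) + of_bool (i \<in> snd \<sigma>)}" for i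
    using convexD[OF convex_real_interval(5), of "x i" "real (fst \<sigma> i)" "real (fst \<sigma> i) + of_bool (i \<in> snd \<sigma>)"
        "y i" "1 - t" t] assms
    by (simp add: cube_def del: of_bool_eq_iff)
  then show ?thesis by (simp add: cube_def)
qed

section \<open>Gluing subcomplexes by means of the staircase\<close>

definition snap :: "nat \<Rightarrow> (nat \<Rightarrow> real) \<Rightarrow> nat \<Rightarrow> real" where
  "snap M x = (\<lambda>i. staircase M (x i))"

lemma continuous_on_snap: "continuous_on S (snap M)"
  unfolding snap_def
proof (rule continuous_on_coordinatewise_then_product)
  fix i
  have "continuous_on S (\<lambda>x::nat \<Rightarrow> real. x i)"
    by (rule continuous_on_coordinate[OF continuous_on_id])
  then show "continuous_on S (\<lambda>x. staircase M (x i))"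
    by (rule continuous_on_compose2[OF continuous_on_staircase[of UNIV]]) simp
qed

lemma snap_in_cube:
  assumes "x \<in> cube \<sigma>" "\<sigma> \<in> grid_cells N M" shows "snap M x \<in> cube \<sigma>"
proof -
  have "real (fst \<sigma> i) \<le> staircase M (x i) \<and> staircase M (x i) \<le> real (fst \<sigma> i + of_bool (i \<in> snd \<sigma>))" for i
  proof
    have M: "fst \<sigma> i + of_bool (i \<in> snd \<sigma>) + 3 \<le> M"
      using assms(2) by (simp add: grid_cells_def)
    have x: "real (fst \<sigma> i) \<le> x i" "x i \<le> real (fst \<sigma> i + of_bool (i \<in> snd \<sigma>))"
      using assms(1) by (auto simp: cube_def)
    have "0 \<le> 1 / real M" by simp
    with x M show "real (fst \<sigma> i) \<le> staircase M (x i)"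
      "staircase M (x i) \<le> real (fst \<sigma> i + of_bool (i \<in> snd \<sigma>))"
      by (intro staircase_ge_nat staircase_le_nat; linarith)+
  qed
  then show ?thesis by (simp add: cube_def snap_def)
qed

text \<open>Restricting only the first \<open>N\<close> coordinates keeps the set open in the
  product topology; on the complexes considered the other coordinates are 0.\<close>

definition cube_nbhd :: "nat \<Rightarrow> nat \<Rightarrow> cell \<Rightarrow> (nat \<Rightarrow> real) set" where
  "cube_nbhd N M \<sigma> = (\<Inter>i<N. {x. real (fst \<sigma> i) - 1 / real M < x i} \<inter>
      {x. x i < real (fst \<sigma> i + of_bool (i \<in> snd \<sigma>)) + 1 / real M})"

lemma open_cube_nbhd: "open (cube_nbhd N M \<sigma>)"
proof -
  have *: "continuous_on UNIV (\<lambda>x::nat \<Rightarrow> real. x i)" for i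
    by (rule continuous_on_coordinate[OF continuous_on_id])
  show ?thesis
    unfolding cube_nbhd_def
    by (intro open_INT ballI open_Int open_Collect_less continuous_on_const * finite_lessThan)
qed

lemma cube_subset_nbhd: "M > 0 \<Longrightarrow> cube \<sigma> \<subseteq> cube_nbhd N M \<sigma>"
proof
  fix x assume M: "M > 0" and x: "x \<in> cube \<sigma>"
  then have "0 < 1 / real M" by simp
  moreover have "real (fst \<sigma> i) \<le> x i" "x i \<le> real (fst \<sigma> i + of_bool (i \<in> snd \<sigma>))" for i
    using x by (simp_all add: cube_def)
  ultimately have "real (fst \<sigma> i) - 1 / real M < x i"
      "x i < real (fst \<sigma> i + of_bool (i \<in> snd \<sigma>)) + 1 / real M" for i
    by (meson less_le_trans le_less_trans diff_less_eq less_add_same_cancel1)+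
  then show "x \<in> cube_nbhd N M \<sigma>"
    unfolding cube_nbhd_def by blast
qed

lemma snap_nbhd:
  assumes "x \<in> cube_nbhd N M \<sigma>" "\<sigma> \<in> grid_cells N M" "\<And>i. i \<ge> N \<Longrightarrow> x i = 0"
  shows "snap M x \<in> cube \<sigma>"
proof -
  have "real (fst \<sigma> i) \<le> staircase M (x i) \<and> staircase M (x i) \<le> real (fst \<sigma> i + of_bool (i \<in> snd \<sigma>))" for i
  proof
    have M: "fst \<sigma> i + of_bool (i \<in> snd \<sigma>) + 3 \<le> M"
      using assms(2) by (simp add: grid_cells_def)
    have x: "real (fst \<sigma> i) - 1 / real M \<le> x i \<and> x i \<le> real (fst \<sigma> i + of_bool (i \<in> snd \<sigma>)) + 1 / real M"
    proof (cases "i < N")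
      case True
      then show ?thesis using assms(1) unfolding cube_nbhd_def by (force intro: less_imp_le)
    next
      case False
      then show ?thesis using assms(2,3) by (simp add: grid_cells_def)
    qed
    show "real (fst \<sigma> i) \<le> staircase M (x i)"
      using x M by (intro staircase_ge_nat; simp)
    show "staircase M (x i) \<le> real (fst \<sigma> i + of_bool (i \<in> snd \<sigma>))"
      using x M by (intro staircase_le_nat; linarith)
  qed
  then show ?thesis by (simp add: cube_def snap_def)
qed

lemma realization_zero:
  assumes "K \<subseteq> grid_cells N M" "x \<in> realization K" "i \<ge> N" shows "x i = 0"
proof -
  obtain \<sigma> where "\<sigma> \<in> K" "x \<in> cube \<sigma>" using assms(2) by (auto simp: realization_def)
  then show ?thesis using assms(1,3) unfolding cube_def grid_cells_def
    by (smt (verit, best) mem_Collect_eq of_bool_eq(1) of_nat_0 subsetD)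
qed

text \<open>Subcomplexes are not open, so they are thickened to \<open>nb K\<close> and
  \<open>nb L\<close>. The map \<open>snap M\<close> pushes the thickenings back, and it is
  homotopic to the identity along segments that stay inside single cubes.\<close>

lemma vanishing_Un:
  assumes j: "j \<ge> 1"
    and K: "subcomplex K" "K \<subseteq> grid_cells N M" "vanishing j K"
    and L: "subcomplex L" "L \<subseteq> grid_cells N M" "vanishing j L"
    and KL: "\<And>z. \<lbrakk>singular_chain j (top_of_set (realization (K \<union> L))) z;
                singular_chain (j - 1) (top_of_set (realization (K \<inter> L))) (chain_boundary j z)\<rbrakk> \<Longrightarrow>
          \<exists>d. singular_chain j (top_of_set (realization (K \<inter> L))) d \<and> chain_boundary j d = chain_boundary j z"
  shows "vanishing j (K \<union> L)"
proof -
  let ?R = "realization (K \<union> L)"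
  define nb where "nb = (\<lambda>K. ?R \<inter> (\<Union>\<sigma>\<in>K. cube_nbhd N M \<sigma>))"
  have sub: "subtopology (top_of_set ?R) S = top_of_set S" if "S \<subseteq> ?R" for S
    using that by (simp add: subtopology_subtopology inf_absorb2)
  have KR: "realization K \<subseteq> ?R" and LR: "realization L \<subseteq> ?R"
    and KLR: "realization K \<inter> realization L \<subseteq> ?R"
    by (auto simp: realization_Un)
  have "snap M ` nb Q \<subseteq> realization Q" if "Q \<subseteq> K \<union> L" for Q
  proof clarify
    fix x assume "x \<in> nb Q"
    then obtain \<sigma> where "\<sigma> \<in> Q" "x \<in> cube_nbhd N M \<sigma>" "x \<in> ?R" by (auto simp: nb_def)
    moreover have "x i = 0" if "i \<ge> N" for i
      using realization_zero[of "K \<union> L" N M x i] K L \<open>x \<in> ?R\<close> that by blast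
    ultimately have "snap M x \<in> cube \<sigma>"
      using K L that by (intro snap_nbhd) auto
    then show "snap M x \<in> realization Q" using \<open>\<sigma> \<in> Q\<close> by (auto simp: realization_def)
  qed
  then have f: "snap M ` nb K \<subseteq> realization K" "snap M ` nb L \<subseteq> realization L" by auto
  have cover: "?R \<subseteq> nb K \<union> nb L"
  proof
    fix x assume "x \<in> ?R"
    then obtain \<sigma> where s: "\<sigma> \<in> K \<union> L" "x \<in> cube \<sigma>" by (auto simp: realization_def)
    then have "M > 0" using K(2) L(2) by (fastforce simp: grid_cells_def)
    then have "x \<in> cube_nbhd N M \<sigma>" using cube_subset_nbhd s by blast
    then show "x \<in> nb K \<union> nb L" using s \<open>x \<in> ?R\<close> by (auto simp: nb_def)
  qed
  have op: "openin (top_of_set ?R) (nb Q)" for Q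
    unfolding nb_def by (intro openin_open_Int open_UN ballI open_cube_nbhd)
  have hom: "homotopic_with (\<lambda>_. True) (top_of_set ?R) (top_of_set ?R) id (snap M)"
  proof (rule homotopic_with_linear_product)
    fix x t assume "x \<in> ?R" and t: "(0::real) \<le> t" "t \<le> 1"
    then obtain \<sigma> where s: "\<sigma> \<in> K \<union> L" "x \<in> cube \<sigma>" by (auto simp: realization_def)
    then have "snap M x \<in> cube \<sigma>" using snap_in_cube K(2) L(2) by blast
    then have "(\<lambda>i. (1 - t) * id x i + t * snap M x i) \<in> cube \<sigma>"
      using cube_convex[OF s(2) _ t] by simp
    then show "(\<lambda>i. (1 - t) * id x i + t * snap M x i) \<in> ?R"
      using s(1) by (auto simp: realization_def)
  qed (auto intro: continuous_on_snap continuous_on_id)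
  show ?thesis
  proof (rule Mayer_Vietoris_vanishing[OF j op op _ hom f])
    show "topspace (top_of_set ?R) \<subseteq> nb K \<union> nb L" using cover by simp
  qed (use K L KL in \<open>simp_all add: sub KR LR KLR realization_Int\<close>)
qed

section \<open>Attaching cells\<close>

lemma finite_grid_cells: "finite (grid_cells N M)"
proof -
  have "finite {f::nat \<Rightarrow> nat. \<forall>i. (i \<in> {..<N} \<longrightarrow> f i \<in> {..M}) \<and> (i \<notin> {..<N} \<longrightarrow> f i = 0)}"
    by (intro finite_set_of_finite_funs) auto
  then have fin: "finite ({f::nat \<Rightarrow> nat. \<forall>i. (i \<in> {..<N} \<longrightarrow> f i \<in> {..M}) \<and> (i \<notin> {..<N} \<longrightarrow> f i = 0)} \<times> Pow {..<N})"
    by (intro finite_cartesian_product) auto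
  have "fst \<sigma> i \<le> M" if "\<sigma> \<in> grid_cells N M" for \<sigma> i
  proof -
    have "fst \<sigma> i + of_bool (i \<in> snd \<sigma>) + 3 \<le> M"
      using that unfolding grid_cells_def by blast
    then show ?thesis by linarith
  qed
  moreover have "snd \<sigma> \<subseteq> {..<N}" "\<And>i. i \<ge> N \<Longrightarrow> fst \<sigma> i = 0" if "\<sigma> \<in> grid_cells N M" for \<sigma>
    using that unfolding grid_cells_def by (auto simp: not_le[symmetric])
  ultimately show ?thesis
    by (intro finite_subset[OF _ fin] subsetI) (simp add: mem_Times_iff del: split_paired_All)
qed

lemma grid_cells_finite_dims: "\<sigma> \<in> grid_cells N M \<Longrightarrow> finite (snd \<sigma>)"
  by (rule finite_subset[of _ "{..<N}"]) (auto simp: grid_cells_def not_le[symmetric])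

lemma card_face_less:
  assumes "face \<tau> \<sigma>" "\<tau> \<noteq> \<sigma>" "finite (snd \<sigma>)"
  shows "card (snd \<tau>) < card (snd \<sigma>)"
  using assms face_subset face_same_dim by (metis psubsetI psubset_card_mono)

lemma real_corner_in_cube: "(\<lambda>i. real (fst \<sigma> i)) \<in> cube \<sigma>"
  by (simp add: cube_def)

lemma cube_upd:
  assumes "x \<in> cube \<sigma>" "real (fst \<sigma> v) \<le> c" "c \<le> real (fst \<sigma> v) + of_bool (v \<in> snd \<sigma>)"
  shows "x(v := c) \<in> cube \<sigma>"
  using assms by (simp add: cube_def)

lemma contractible_space_cube: "contractible_space (top_of_set (cube \<sigma>))"
  unfolding contractible_space_def
proof
  show "homotopic_with (\<lambda>x. True) (top_of_set (cube \<sigma>)) (top_of_set (cube \<sigma>)) id (\<lambda>x i. real (fst \<sigma> i))"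
  proof (rule homotopic_with_linear_product)
    fix x t assume "x \<in> cube \<sigma>" and t: "(0::real) \<le> t" "t \<le> 1"
    then show "(\<lambda>i. (1 - t) * id x i + t * real (fst \<sigma> i)) \<in> cube \<sigma>"
      using cube_convex[OF _ real_corner_in_cube t] by simp
  qed (auto intro: continuous_on_id continuous_on_const)
qed

lemma vanishing_empty: "vanishing j {}"
  unfolding realization_def by (rule trivial_homology_group_empty) simp

lemma vanishing_faces: "j \<ge> 1 \<Longrightarrow> vanishing j {\<tau>. face \<tau> \<sigma>}"
  unfolding realization_faces
  by (rule trivial_homology_group_contractible_space[OF contractible_space_cube])

lemma vanishing_insert_if_boundary:
  assumes j: "j \<ge> 1" and K: "subcomplex K" "subcomplex (insert \<sigma> K)" "insert \<sigma> K \<subseteq> grid_cells N M"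
    and bd: "vanishing (j - 1) (K \<inter> {\<tau>. face \<tau> \<sigma>})" and van: "vanishing j K"
  shows "vanishing j (insert \<sigma> K)"
proof -
  let ?L = "{\<tau>. face \<tau> \<sigma>}"
  have eq: "insert \<sigma> K = K \<union> ?L"
    using K(2) face_refl by (auto simp del: split_paired_All dest: subcomplexD)
  have "vanishing j (K \<union> ?L)"
  proof (rule vanishing_Un[OF j K(1) _ van subcomplex_faces])
    show "K \<subseteq> grid_cells N M" "?L \<subseteq> grid_cells N M"
      using K(3) eq by auto
  next
    fix z assume z: "singular_chain j (top_of_set (realization (K \<union> ?L))) z"
      and dz: "singular_chain (j - 1) (top_of_set (realization (K \<inter> ?L))) (chain_boundary j z)"
    then have "singular_relcycle (j - 1) (top_of_set (realization (K \<inter> ?L))) {} (chain_boundary j z)"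
      using chain_boundary_boundary[OF z] by (simp add: singular_cycle)
    then have "singular_relboundary (j - 1) (top_of_set (realization (K \<inter> ?L))) {} (chain_boundary j z)"
      using bd unfolding trivial_homology_group_iff by blast
    then show "\<exists>d. singular_chain j (top_of_set (realization (K \<inter> ?L))) d \<and> chain_boundary j d = chain_boundary j z"
      using j by (simp add: singular_boundary)
  qed (rule vanishing_faces[OF j])
  then show ?thesis by (simp only: eq)
qed

text \<open>Induction on the degree and on the number of cells. A cell of largest dimension is no
  proper face, so it can be taken off; it was glued along cells of smaller dimension, to which the
  claim one degree lower applies. In degree 0 the hypothesis leaves only the empty complex.\<close>

lemma vanishing_above_dimension:
  assumes "subcomplex K" "K \<subseteq> grid_cells N M" "\<And>\<sigma>. \<sigma> \<in> K \<Longrightarrow> card (snd \<sigma>) < j"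
  shows "vanishing j K"
  using assms
proof (induction j arbitrary: K)
  case 0
  then have "K = {}" by auto
  then show ?case using vanishing_empty by blast
next
  case (Suc j)
  have "finite K" using Suc.prems(2) finite_grid_cells finite_subset by blast
  then show ?case using Suc.prems
  proof (induction "card K" arbitrary: K)
    case 0
    then have "K = {}" by simp
    then show ?case using vanishing_empty by blast
  next
    case (Suc k)
    note outer = \<open>\<And>K. subcomplex K \<Longrightarrow> K \<subseteq> grid_cells N M \<Longrightarrow> (\<And>\<sigma>. \<sigma> \<in> K \<Longrightarrow> card (snd \<sigma>) < j) \<Longrightarrow> vanishing j K\<close>
    have "K \<noteq> {}" using Suc.hyps(2) by auto
    define m where "m = Max ((\<lambda>\<sigma>. card (snd \<sigma>)) ` K)"
    have "m \<in> (\<lambda>\<sigma>. card (snd \<sigma>)) ` K"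
      unfolding m_def using Suc.prems(1) \<open>K \<noteq> {}\<close> by (intro Max_in) auto
    then obtain \<sigma> where \<sigma>: "\<sigma> \<in> K" "card (snd \<sigma>) = m" by auto
    have mx: "card (snd \<tau>) \<le> card (snd \<sigma>)" if "\<tau> \<in> K" for \<tau>
      unfolding \<sigma>(2) m_def using Suc.prems(1) that by (intro Max_ge) auto
    have K0: "subcomplex (K - {\<sigma>})"
      unfolding subcomplex_def
    proof (intro ballI allI impI)
      fix \<rho> \<tau> assume "\<rho> \<in> K - {\<sigma>}" "face \<tau> \<rho>"
      then show "\<tau> \<in> K - {\<sigma>}"
        using card_face_less[of \<tau> \<rho>] mx[of \<rho>] Suc.prems grid_cells_finite_dims[of \<rho> N M]
          subcomplexD[of K \<rho> \<tau>] by (cases "\<tau> = \<rho>") auto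
    qed
    have "vanishing (Suc j) (K - {\<sigma>})"
      using Suc.hyps(2) Suc.prems \<sigma>(1) by (intro Suc.hyps(1) K0) auto
    moreover have "vanishing j ((K - {\<sigma>}) \<inter> {\<tau>. face \<tau> \<sigma>})"
    proof (rule outer)
      show "subcomplex ((K - {\<sigma>}) \<inter> {\<tau>. face \<tau> \<sigma>})"
        by (intro subcomplex_Int K0 subcomplex_faces)
      fix \<tau> assume "\<tau> \<in> (K - {\<sigma>}) \<inter> {\<tau>. face \<tau> \<sigma>}"
      then have "card (snd \<tau>) < card (snd \<sigma>)"
        using \<sigma>(1) Suc.prems(3) grid_cells_finite_dims[of \<sigma> N M] by (intro card_face_less) auto
      then show "card (snd \<tau>) < j" using Suc.prems(4)[OF \<sigma>(1)] by simp
    qed (use Suc.prems in auto)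
    ultimately have "vanishing (Suc j) (insert \<sigma> (K - {\<sigma>}))"
      using Suc.prems \<sigma>(1) K0 by (intro vanishing_insert_if_boundary) (auto simp: insert_absorb)
    then show ?case using \<sigma>(1) by (simp add: insert_absorb)
  qed
qed

text \<open>The new cell is glued along proper faces, of dimension below \<open>j - 1\<close>, so
  nothing in degree \<open>j - 1\<close> obstructs the gluing.\<close>

lemma vanishing_insert:
  assumes "subcomplex K" "subcomplex (insert \<sigma> K)" "insert \<sigma> K \<subseteq> grid_cells N M"
    and "\<sigma> \<notin> K" "card (snd \<sigma>) < j" "vanishing j K"
  shows "vanishing j (insert \<sigma> K)"
proof (rule vanishing_insert_if_boundary[OF _ assms(1-3) _ assms(6)])
  show "vanishing (j - 1) (K \<inter> {\<tau>. face \<tau> \<sigma>})"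
  proof (rule vanishing_above_dimension)
    fix \<tau> assume "\<tau> \<in> K \<inter> {\<tau>. face \<tau> \<sigma>}"
    then have "card (snd \<tau>) < card (snd \<sigma>)"
      using assms(3,4) grid_cells_finite_dims[of \<sigma> N M] by (intro card_face_less) auto
    then show "card (snd \<tau>) < j - 1" using assms(5) by simp
  next
    show "K \<inter> {\<tau>. face \<tau> \<sigma>} \<subseteq> grid_cells N M" using assms(3) by auto
  qed (intro subcomplex_Int assms subcomplex_faces)
qed (use assms in auto)

text \<open>This is the boundary of a cube without the interior of its lower facet in direction
  \<open>v\<close>, a box without bottom. Raising coordinate \<open>v\<close> moves it into the
  opposite facet \<open>?T\<close>, which contracts to its lowest corner.\<close>

lemma contractible_space_open_box:
  assumes "v \<notin> S"
  shows "contractible_space (top_of_set (realization ({\<tau>. face \<tau> (a, insert v S)} - {(a, insert v S), (a, S)})))"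
proof -
  let ?\<sigma> = "(a, insert v S)" and ?T = "(a(v := a v + 1), S)"
  let ?Y = "{\<tau>. face \<tau> ?\<sigma>} - {?\<sigma>, (a, S)}"
  let ?R = "realization ?Y"
  have T: "?T \<in> ?Y"
    using assms by (auto simp: face_def fun_eq_iff)
  have TR: "cube ?T \<subseteq> ?R" using T by (auto simp: realization_def)
  have push: "(\<lambda>i. (1 - t) * x i + t * (x(v := real (a v + 1))) i) \<in> ?R" (is "?p \<in> _")
    if xR: "x \<in> ?R" and t: "0 \<le> t" "t \<le> 1" for x t
  proof -
    obtain \<rho> where "\<rho> \<in> ?Y" "x \<in> cube \<rho>"
      using xR unfolding realization_def by (rule UN_E)
    then have \<rho>: "face \<rho> ?\<sigma>" "\<rho> \<noteq> ?\<sigma>" "\<rho> \<noteq> (a, S)" "x \<in> cube \<rho>"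
      by blast+
    obtain b R where bR: "\<rho> = (b, R)" by (cases \<rho>)
    \<comment> \<open>The prism over \<open>\<rho>\<close> in direction \<open>v\<close> contains
      the whole segment along which \<open>x\<close> is raised.\<close>
    let ?\<rho>' = "(b(v := a v), insert v R)"
    have pw: "a i \<le> b i" "b i + of_bool (i \<in> R) \<le> a i + of_bool (i \<in> insert v S)" for i
      using \<rho>(1) unfolding bR face_def fst_conv snd_conv by blast+
    have f': "face ?\<rho>' ?\<sigma>"
      unfolding face_def
    proof
      fix i show "fst ?\<sigma> i \<le> fst ?\<rho>' i \<and>
        fst ?\<rho>' i + of_bool (i \<in> snd ?\<rho>') \<le> fst ?\<sigma> i + of_bool (i \<in> snd ?\<sigma>)"
        using pw[of i] by (cases "i = v") auto
    qed
    have "face \<rho> ?\<rho>'"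
      unfolding face_def bR
    proof
      fix i show "fst ?\<rho>' i \<le> fst (b, R) i \<and>
        fst (b, R) i + of_bool (i \<in> snd (b, R)) \<le> fst ?\<rho>' i + of_bool (i \<in> snd ?\<rho>')"
        using pw[of i] by (cases "i = v") auto
    qed
    then have sub: "cube \<rho> \<subseteq> cube ?\<rho>'"
      by (rule cube_mono)
    have xv: "real (a v) \<le> x v" "x v \<le> real (a v) + 1"
      using subsetD[OF cube_mono[OF \<rho>(1)] \<rho>(4)] by (auto simp: cube_def dest!: spec[of _ v])
    show ?thesis
    proof (cases "?\<rho>' = ?\<sigma>")
      case False
      then have "?\<rho>' \<in> ?Y" using f' assms by auto
      moreover have "x(v := real (a v + 1)) \<in> cube ?\<rho>'"
        using subsetD[OF sub \<rho>(4)] by (intro cube_upd) auto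
      then have "?p \<in> cube ?\<rho>'"
        by (rule cube_convex[OF subsetD[OF sub \<rho>(4)] _ t])
      ultimately show ?thesis by (auto simp: realization_def)
    next
      \<comment> \<open>If the prism is the full cube, then \<open>\<rho>\<close> can only be the
        upper facet, because the cube and its lower facet are excluded; there \<open>x\<close> does
        not move.\<close>
      case True
      have "R - {v} = S" using True assms by auto
      moreover have b: "b = a(v := b v)" using True by (metis fun_upd_triv fun_upd_upd fst_conv)
      have bv: "a v \<le> b v" "b v + of_bool (v \<in> R) \<le> a v + 1"
        using pw[of v] by simp_all
      have "v \<notin> R"
      proof
        assume "v \<in> R"
        then have "b v = a v" using bv by simp
        with b have "b = a" by simp
        with True \<open>v \<in> R\<close> \<rho>(2) bR show False by (auto simp: insert_absorb)
      qed
      then have "R = S" using \<open>R - {v} = S\<close> by simp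
      moreover have "b v \<noteq> a v" using \<rho>(3) b \<open>R = S\<close> bR by (metis fun_upd_triv)
      then have "b v = a v + 1" using bv \<open>v \<notin> R\<close> by simp
      then have "x v = real (a v + 1)"
        using \<rho>(4) \<open>v \<notin> R\<close> by (auto simp: bR cube_def dest!: spec[of _ v])
      then have "?p = x" by (auto simp: fun_eq_iff algebra_simps)
      then show ?thesis using xR by simp
    qed
  qed
  have up: "x(v := real (a v + 1)) \<in> cube ?T" if "x \<in> ?R" for x
  proof -
    have "x \<in> cube ?\<sigma>" using that cube_mono by (fastforce simp: realization_def)
    then have *: "real (a i) \<le> x i" "x i \<le> real (a i) + of_bool (i \<in> insert v S)" for i
      by (simp_all add: cube_def)
    have "real (fst ?T i) \<le> (x(v := real (a v + 1))) i \<and>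
        (x(v := real (a v + 1))) i \<le> real (fst ?T i) + of_bool (i \<in> snd ?T)" for i
      using *[of i] assms by (cases "i = v") auto
    then show ?thesis unfolding cube_def by blast
  qed
  have cont: "continuous_on ?R (\<lambda>x. x(v := real (a v + 1)))"
  proof (rule continuous_on_coordinatewise_then_product)
    fix i show "continuous_on ?R (\<lambda>x. (x(v := real (a v + 1))) i)"
      by (cases "i = v") (auto intro!: continuous_on_const continuous_on_coordinate[OF continuous_on_id])
  qed
  have 1: "homotopic_with (\<lambda>_. True) (top_of_set ?R) (top_of_set ?R) id (\<lambda>x. x(v := real (a v + 1)))"
    by (rule homotopic_with_linear_product) (use push cont in \<open>auto intro: continuous_on_id\<close>)
  have 2: "homotopic_with (\<lambda>_. True) (top_of_set ?R) (top_of_set ?R)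
      (\<lambda>x. x(v := real (a v + 1))) (\<lambda>x i. real (fst ?T i))"
  proof (rule homotopic_with_linear_product)
    fix x t assume "x \<in> ?R" and t: "(0::real) \<le> t" "t \<le> 1"
    then show "(\<lambda>i. (1 - t) * (x(v := real (a v + 1))) i + t * real (fst ?T i)) \<in> ?R"
      using cube_convex[OF up real_corner_in_cube t] TR by blast
  qed (use cont in \<open>auto intro: continuous_on_const\<close>)
  show ?thesis
    unfolding contractible_space_def using homotopic_with_trans[OF 1 2] by blast
qed

text \<open>An elementary expansion: \<open>(a, S)\<close> is a face of no cell of \<open>K\<close>,
  so the new cube meets \<open>K\<close> exactly in the box without bottom.\<close>

lemma vanishing_insert_pair:
  assumes j: "j \<ge> 1" and v: "v \<notin> S"
    and K: "subcomplex K" "subcomplex (K \<union> {(a, insert v S), (a, S)})"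
       "K \<union> {(a, insert v S), (a, S)} \<subseteq> grid_cells N M"
    and new: "(a, insert v S) \<notin> K" "(a, S) \<notin> K" and van: "vanishing j K"
  shows "vanishing j (K \<union> {(a, insert v S), (a, S)})"
proof -
  let ?\<sigma> = "(a, insert v S)"
  let ?L = "{\<tau>. face \<tau> ?\<sigma>}"
  have LK: "?L \<subseteq> K \<union> {?\<sigma>, (a, S)}"
    using subcomplexD[OF K(2), of ?\<sigma>] by blast
  have "face (a, S) ?\<sigma>" using v by (simp add: face_def)
  then have eq: "K \<union> {?\<sigma>, (a, S)} = K \<union> ?L"
    using LK face_refl by auto
  have KL: "K \<inter> ?L = ?L - {?\<sigma>, (a, S)}"
    using LK new by auto
  have "vanishing j (K \<union> ?L)"
  proof (rule vanishing_Un[OF j K(1) _ van subcomplex_faces])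
    show "K \<subseteq> grid_cells N M" "?L \<subseteq> grid_cells N M"
      using K(3) eq by auto
  next
    fix z assume z: "singular_chain j (top_of_set (realization (K \<union> ?L))) z"
      and dz: "singular_chain (j - 1) (top_of_set (realization (K \<inter> ?L))) (chain_boundary j z)"
    let ?X = "top_of_set (realization (K \<union> ?L))" and ?S = "realization (K \<inter> ?L)"
    have "?S \<subseteq> realization (K \<union> ?L)"
      unfolding realization_def by blast
    then have eqS: "subtopology ?X ?S = top_of_set ?S"
      by (simp only: subtopology_subtopology inf_absorb2)
    show "\<exists>d. singular_chain j (top_of_set ?S) d \<and> chain_boundary j d = chain_boundary j z"
      by (rule boundary_bounds_in_contractible[of ?X ?S j z, unfolded eqS,
            OF contractible_space_open_box[OF v, of a, folded KL] j z dz])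
  qed (rule vanishing_faces[OF j])
  then show ?thesis by (simp only: eq)
qed

text \<open>The pairs of cells are removed by elementary collapses, starting from a largest one.\<close>

lemma vanishing_Un_toggle:
  assumes j: "j \<ge> 1" and fin: "finite \<G>"
    and K: "subcomplex K" "subcomplex (K \<union> Pair a ` \<G>)" "K \<union> Pair a ` \<G> \<subseteq> grid_cells N M"
    and new: "K \<inter> Pair a ` \<G> = {}" and van: "vanishing j K"
    and toggle: "\<And>S. S \<in> \<G> \<Longrightarrow> insert v S \<in> \<G> \<and> S - {v} \<in> \<G>"
  shows "vanishing j (K \<union> Pair a ` \<G>)"
  using fin K(2,3) new toggle
proof (induction "card \<G>" arbitrary: \<G> rule: less_induct)
  case less
  show ?case
  proof (cases "\<G> = {}")
    case True
    then show ?thesis using van by simp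
  next
    case False
    have "Max (card ` \<G>) \<in> card ` \<G>"
      using less.prems(1) False by (intro Max_in) auto
    then obtain S1 where S1: "S1 \<in> \<G>" "card S1 = Max (card ` \<G>)" by auto
    have mx: "card S \<le> card S1" if "S \<in> \<G>" for S
      unfolding S1(2) using less.prems(1) that by (intro Max_ge) auto
    have finS: "finite S" if "S \<in> \<G>" for S
      using less.prems(3) that grid_cells_finite_dims[of "(a, S)" N M] by auto
    have "v \<in> S1"
      using mx[of "insert v S1"] less.prems(5)[OF S1(1)] finS[OF S1(1)]
      by (metis card_insert_disjoint not_less_eq_eq order_refl)
    define S0 where "S0 = S1 - {v}"
    have S0: "S0 \<in> \<G>" "v \<notin> S0" "S1 = insert v S0"
      using less.prems(5)[OF S1(1)] \<open>v \<in> S1\<close> by (auto simp: S0_def)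
    let ?\<H> = "\<G> - {S0, S1}"
    have eq: "K \<union> Pair a ` \<G> = (K \<union> Pair a ` ?\<H>) \<union> {(a, insert v S0), (a, S0)}"
      using S1(1) S0 by auto
    \<comment> \<open>A remaining set \<open>S\<close> that contains \<open>S0\<close> would give
      \<open>S1 \<subseteq> insert v S\<close>, hence equality because \<open>S1\<close> has maximal
      size; but then \<open>S\<close> is \<open>S0\<close> or \<open>S1\<close>. So no remaining
      cell has a removed one as a face.\<close>
    have H: "subcomplex (K \<union> Pair a ` ?\<H>)"
      unfolding subcomplex_def
    proof (intro ballI allI impI)
      fix \<rho> \<tau> assume \<rho>: "\<rho> \<in> K \<union> Pair a ` ?\<H>" and f: "face \<tau> \<rho>"
      then have \<tau>: "\<tau> \<in> K \<union> Pair a ` \<G>"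
        using less.prems(2) unfolding subcomplex_def by blast
      show "\<tau> \<in> K \<union> Pair a ` ?\<H>"
      proof (rule ccontr)
        assume "\<not> ?thesis"
        then have \<tau>': "\<tau> = (a, S0) \<or> \<tau> = (a, S1)" "\<tau> \<notin> K" using \<tau> by auto
        then have "\<rho> \<notin> K" using f subcomplexD[OF K(1)] by blast
        then obtain S where S: "S \<in> ?\<H>" "\<rho> = (a, S)" using \<rho> by auto
        have "S0 \<subseteq> S" using face_subset[OF f] \<tau>' S(2) S0(3) by auto
        then have "S1 \<subseteq> insert v S" using S0 by auto
        moreover have "card (insert v S) \<le> card S1" "finite (insert v S)"
          using mx less.prems(5) S finS by auto
        ultimately have "S1 = insert v S" by (metis card_seteq)
        then have "S = S0 \<or> S = S1" using S0 by (metis Diff_insert_absorb insert_absorb)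
        then show False using S by auto
      qed
    qed
    have "vanishing j (K \<union> Pair a ` ?\<H>)"
    proof (rule less.hyps)
      show "card ?\<H> < card \<G>"
        using S1(1) less.prems(1) by (intro psubset_card_mono) auto
      show "insert v S \<in> ?\<H> \<and> S - {v} \<in> ?\<H>" if S: "S \<in> ?\<H>" for S
      proof -
        have "insert v S \<in> \<G>" "S - {v} \<in> \<G>" using less.prems(5) S by auto
        moreover have "insert v S \<noteq> S0" "S - {v} \<noteq> S1"
          using S0 \<open>v \<in> S1\<close> by auto
        moreover have "insert v S \<noteq> S1"
        proof
          assume "insert v S = S1"
          then have "S = S0 \<or> S = S1" using S0 by (metis Diff_insert_absorb insert_absorb)
          then show False using S by auto
        qed
        moreover have "S - {v} \<noteq> S0"
        proof
          assume "S - {v} = S0"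
          then have "S = S0 \<or> S = S1" using S0 by (metis Diff_empty Diff_insert0 insert_Diff)
          then show False using S by auto
        qed
        ultimately show ?thesis by auto
      qed
    qed (use H less.prems in auto)
    then show ?thesis
      unfolding eq
    proof (intro vanishing_insert_pair[OF j S0(2) H])
      show "subcomplex (K \<union> Pair a ` ?\<H> \<union> {(a, insert v S0), (a, S0)})"
        "K \<union> Pair a ` ?\<H> \<union> {(a, insert v S0), (a, S0)} \<subseteq> grid_cells N M"
        unfolding eq[symmetric] using less.prems by simp_all
    qed (use less.prems(4) S0 S1(1) in auto)
  qed
qed

section \<open>Independence complexes of paths\<close>

text \<open>The empty set is included: it will index the vertex at the corner, so that the dimension
  of a cell is the size of its set and not one less.\<close>

definition independent_sets :: "(nat \<Rightarrow> nat \<Rightarrow> bool) \<Rightarrow> nat set \<Rightarrow> nat set set" where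
  "independent_sets adj T = {I. I \<subseteq> T \<and> (\<forall>i\<in>I. \<forall>k\<in>I. \<not> adj i k)}"

text \<open>The potential \<open>\<kappa>\<close> enumerates each component of the graph as a path; the weight \<open>\<mu>\<close> bounds the
  number of recursion steps in the computation of the homotopy type of the independence complex
  of a union of paths by folding at leaves.\<close>

lemma vanishing_Un_independent:
  fixes \<kappa> :: "nat \<Rightarrow> int" and \<mu> :: "nat set \<Rightarrow> real"
  assumes sym: "\<And>i k. adj i k \<Longrightarrow> adj k i"
    and \<kappa>: "\<And>i k. adj i k \<Longrightarrow> \<bar>\<kappa> i - \<kappa> k\<bar> = 1"
    and \<kappa>_inj: "\<And>i k l. \<lbrakk>adj i k; adj i l; \<kappa> k = \<kappa> l\<rbrakk> \<Longrightarrow> k = l"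
    and \<mu>_nonneg: "\<And>T. 0 \<le> \<mu> T"
    and \<mu>_leaf: "\<And>T v w. \<lbrakk>T \<subseteq> V; v \<in> T; w \<in> T; adj v w; \<And>u. u \<in> T \<Longrightarrow> adj v u \<Longrightarrow> u = w\<rbrakk> \<Longrightarrow>
                   \<mu> (T - {u. u = w \<or> adj w u}) + 1 \<le> \<mu> T"
    and V: "finite V"
    and T: "T \<subseteq> V" "J \<inter> T = {}" "finite J" "\<mu> T < real j - real (card J)"
    and K: "subcomplex K" "subcomplex (K \<union> Pair a ` (\<union>) J ` independent_sets adj T)"
       "K \<union> Pair a ` (\<union>) J ` independent_sets adj T \<subseteq> grid_cells N M"
       "K \<inter> Pair a ` (\<union>) J ` independent_sets adj T = {}"
    and van: "vanishing j K"
  shows "vanishing j (K \<union> Pair a ` (\<union>) J ` independent_sets adj T)"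
  using T K van
proof (induction "card T" arbitrary: T J K rule: less_induct)
  case less
  have finT: "finite T" using less.prems(1) V finite_subset by blast
  let ?G = "\<lambda>J T. (\<union>) J ` independent_sets adj T"
  have irr: "\<not> adj i i" for i using \<kappa>[of i i] by auto
  have fin: "finite (?G J Q)" if "Q \<subseteq> T" for J Q
  proof -
    have "independent_sets adj Q \<subseteq> Pow T" using that by (auto simp: independent_sets_def)
    then show ?thesis using finT by (meson finite_Pow_iff finite_imageI finite_subset)
  qed
  have j: "card J < j" "j \<ge> 1"
    using less.prems(4) \<mu>_nonneg[of T] by linarith+
  show ?case
  proof (cases "T = {}")
    case True
    \<comment> \<open>No moves are left, and the single unmatched cell has the moves in
      \<open>J\<close>; its dimension \<open>card J\<close> is below \<open>j\<close>.\<close>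
    then have "independent_sets adj T = {{}}" by (auto simp: independent_sets_def)
    then have G: "?G J T = {J}" by auto
    have eq: "K \<union> Pair a ` {J} = insert (a, J) K" by auto
    show ?thesis
      using less.prems(5-9) j unfolding G eq
      by (intro vanishing_insert) auto
  next
    case False
    \<comment> \<open>A vertex of least potential is isolated or a leaf: all its neighbours in
      \<open>T\<close> have potential \<open>\<kappa> v + 1\<close>, hence coincide.\<close>
    define v where "v = arg_min_on \<kappa> T"
    have v: "v \<in> T" "\<And>u. u \<in> T \<Longrightarrow> \<kappa> v \<le> \<kappa> u"
      unfolding v_def using arg_min_if_finite(1)[OF finT False] arg_min_least[OF finT False] by auto
    have leaf: "u = w" if "u \<in> T" "adj v u" "w \<in> T" "adj v w" for u w
      using \<kappa>[OF that(2)] \<kappa>[OF that(4)] v(2)[OF that(1)] v(2)[OF that(3)] \<kappa>_inj[OF that(2,4)] by linarith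
    \<comment> \<open>If \<open>v\<close> has no neighbour in \<open>Q\<close>, the complex is a
      cone with apex \<open>v\<close>, and adding or deleting \<open>v\<close> matches all its
      cells.\<close>
    have tog: "insert v S \<in> ?G J Q \<and> S - {v} \<in> ?G J Q"
      if S: "S \<in> ?G J Q" and Q: "Q \<subseteq> T" "v \<in> Q" "\<And>u. u \<in> Q \<Longrightarrow> \<not> adj v u" for S Q
    proof -
      obtain I where I: "I \<in> independent_sets adj Q" "S = J \<union> I" using S by auto
      have "insert v I \<in> independent_sets adj Q" "I - {v} \<in> independent_sets adj Q"
        using I(1) Q sym irr unfolding independent_sets_def by blast+
      moreover have "insert v S = J \<union> insert v I" "S - {v} = J \<union> (I - {v})"
        using I(2) v(1) less.prems(2) by auto
      ultimately show ?thesis by blast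
    qed
    show ?thesis
    proof (cases "\<exists>w\<in>T. adj v w")
      case False
      show ?thesis
        by (rule vanishing_Un_toggle[OF j(2) fin[OF order_refl] less.prems(5-9), of v])
           (use tog[of _ T] v(1) False in blast)
    next
      case True
      then obtain w where w: "w \<in> T" "adj v w" by blast
      \<comment> \<open>The sets avoiding \<open>w\<close> form a cone, since \<open>v\<close> has
        lost its only neighbour. Those containing \<open>w\<close> are independent sets of
        \<open>?T'\<close> with \<open>w\<close> added, so \<open>w\<close> moves into
        \<open>J\<close>: the budget \<open>j - card J\<close> falls by one, and so does
        \<open>\<mu>\<close> at least.\<close>
      let ?T' = "T - {u. u = w \<or> adj w u}"
      let ?K1 = "K \<union> Pair a ` ?G J (T - {w})"
      have split: "independent_sets adj T = independent_sets adj (T - {w}) \<union> insert w ` independent_sets adj ?T'"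
      proof (intro equalityI subsetI)
        fix I assume I: "I \<in> independent_sets adj T"
        show "I \<in> independent_sets adj (T - {w}) \<union> insert w ` independent_sets adj ?T'"
        proof (cases "w \<in> I")
          case True
          then have "I - {w} \<in> independent_sets adj ?T'" "I = insert w (I - {w})"
            using I unfolding independent_sets_def by blast+
          then show ?thesis by blast
        qed (use I in \<open>auto simp: independent_sets_def\<close>)
      next
        fix I assume "I \<in> independent_sets adj (T - {w}) \<union> insert w ` independent_sets adj ?T'"
        then show "I \<in> independent_sets adj T"
          using w(1) sym irr unfolding independent_sets_def by blast
      qed
      have split': "?G J T = ?G J (T - {w}) \<union> ?G (insert w J) ?T'"
        unfolding split image_Un image_image by auto
      have eq: "K \<union> Pair a ` ?G J T = ?K1 \<union> Pair a ` ?G (insert w J) ?T'"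
        unfolding split' by auto
      have wnot: "w \<notin> S" if "S \<in> ?G J (T - {w})" for S
        using that w(1) less.prems(2) by (auto simp: independent_sets_def)
      have K1: "subcomplex ?K1"
        unfolding subcomplex_def
      proof (intro ballI allI impI)
        fix \<rho> \<tau> assume \<rho>: "\<rho> \<in> ?K1" and f: "face \<tau> \<rho>"
        have \<tau>: "\<tau> \<in> K \<union> Pair a ` ?G J T"
          using subcomplexD[OF less.prems(6) UnI1[OF \<rho>, of "Pair a ` ?G (insert w J) ?T'", folded eq] f] .
        show "\<tau> \<in> ?K1"
        proof (cases "\<rho> \<in> K")
          case True
          then show ?thesis using subcomplexD[OF less.prems(5) _ f] by simp
        next
          case False
          then have "\<rho> \<in> Pair a ` ?G J (T - {w})" using \<rho> by (meson UnE)
          then obtain S where "\<rho> = (a, S)" "S \<in> ?G J (T - {w})" by (rule imageE)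
          then have "w \<notin> snd \<rho>" using wnot[of S] by simp
          then have "w \<notin> snd \<tau>" using face_subset[OF f] by (meson subsetD)
          then have "\<tau> \<notin> Pair a ` ?G (insert w J) ?T'" by auto
          then show ?thesis using \<tau> unfolding eq by simp
        qed
      qed
      have sub: "?K1 \<subseteq> grid_cells N M"
        using less.prems(7) unfolding eq by simp
      have dis: "K \<inter> Pair a ` ?G J (T - {w}) = {}"
        using less.prems(8) unfolding split' by (simp add: image_Un Int_Un_distrib)
      have "insert v S \<in> ?G J (T - {w}) \<and> S - {v} \<in> ?G J (T - {w})" if "S \<in> ?G J (T - {w})" for S
        using tog[OF that] v(1) leaf[OF _ _ w] irr[of v] w(2) by blast
      then have van1: "vanishing j ?K1"
        using fin[of "T - {w}" J] by (intro vanishing_Un_toggle[OF j(2) _ less.prems(5) K1 sub dis less.prems(9)]) auto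
      have \<mu>T: "\<mu> ?T' + 1 \<le> \<mu> T"
        using \<mu>_leaf[OF less.prems(1) v(1) w] leaf[OF _ _ w] by blast
      show ?thesis
        unfolding eq
      proof (rule less.hyps)
        show "card ?T' < card T" using w(1) finT by (intro psubset_card_mono) auto
        have "w \<notin> J" using w(1) less.prems(2) by blast
        then have "card (insert w J) = Suc (card J)" using less.prems(3) by simp
        then show "\<mu> ?T' < real j - real (card (insert w J))"
          using less.prems(4) \<mu>T by simp
        show "subcomplex (?K1 \<union> Pair a ` ?G (insert w J) ?T')"
          "?K1 \<union> Pair a ` ?G (insert w J) ?T' \<subseteq> grid_cells N M"
          using less.prems(6,7) unfolding eq .
        show "?K1 \<inter> Pair a ` ?G (insert w J) ?T' = {}"
        proof (rule equals0I)
          fix \<rho> assume \<rho>: "\<rho> \<in> ?K1 \<inter> Pair a ` ?G (insert w J) ?T'"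
          then have "\<rho> \<in> Pair a ` ?G J T" unfolding split' image_Un by (meson IntD2 UnI2)
          then have "\<rho> \<notin> K" using less.prems(8) by (meson disjoint_iff)
          then have "\<rho> \<in> Pair a ` ?G J (T - {w})" using \<rho> by (meson IntD1 UnE)
          then obtain S where S: "\<rho> = (a, S)" "S \<in> ?G J (T - {w})" by (rule imageE)
          obtain S' where "\<rho> = (a, S')" "S' \<in> ?G (insert w J) ?T'"
            using IntD2[OF \<rho>] by (rule imageE)
          then have "w \<in> S" using S(1) by auto
          then show False using wnot[OF S(2)] by simp
        qed
        show "?T' \<subseteq> V" "insert w J \<inter> ?T' = {}" "finite (insert w J)"
          using less.prems(1,2,3) by blast+
      qed (rule K1 van1)+
    qed
  qed
qed

text \<open>Passing to a face can only raise the lowest corner, so cells whose corners lie in an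
  upward closed set form a subcomplex. Taking away a corner of least coordinate sum keeps the set
  upward closed: a corner below it pointwise has the same sum and is therefore equal to it.\<close>

lemma vanishing_by_corners:
  assumes X: "subcomplex X" "X \<subseteq> grid_cells N M"
    and step: "\<And>a K. \<lbrakk>a \<in> fst ` X; subcomplex K; K \<subseteq> X; subcomplex (K \<union> Pair a ` {S. (a, S) \<in> X});
        K \<inter> Pair a ` {S. (a, S) \<in> X} = {}; vanishing j K\<rbrakk> \<Longrightarrow> vanishing j (K \<union> Pair a ` {S. (a, S) \<in> X})"
  shows "vanishing j X"
proof -
  have finX: "finite X" using X(2) finite_grid_cells finite_subset by blast
  have sub: "subcomplex {\<sigma> \<in> X. fst \<sigma> \<in> A}"
    if "\<And>a b. \<lbrakk>a \<in> A; b \<in> fst ` X; \<And>i. a i \<le> b i\<rbrakk> \<Longrightarrow> b \<in> A" for A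
    unfolding subcomplex_def
  proof (intro ballI allI impI)
    fix \<sigma> \<tau> assume \<sigma>: "\<sigma> \<in> {\<sigma> \<in> X. fst \<sigma> \<in> A}" and f: "face \<tau> \<sigma>"
    then have "\<tau> \<in> X" using subcomplexD[OF X(1)] by blast
    moreover have "fst \<sigma> i \<le> fst \<tau> i" for i using f unfolding face_def by blast
    ultimately show "\<tau> \<in> {\<sigma> \<in> X. fst \<sigma> \<in> A}" using \<sigma> that[of "fst \<sigma>" "fst \<tau>"] by blast
  qed
  have "vanishing j {\<sigma> \<in> X. fst \<sigma> \<in> A}"
    if "finite A" "A \<subseteq> fst ` X" "\<And>a b. \<lbrakk>a \<in> A; b \<in> fst ` X; \<And>i. a i \<le> b i\<rbrakk> \<Longrightarrow> b \<in> A" for A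
    using that
  proof (induction "card A" arbitrary: A rule: less_induct)
    case less
    show ?case
    proof (cases "A = {}")
      case True
      then have "{\<sigma> \<in> X. fst \<sigma> \<in> A} = {}" by simp
      then show ?thesis using vanishing_empty by (simp only:)
    next
      case False
      define h where "h = (\<lambda>a::nat \<Rightarrow> nat. \<Sum>i<N. a i)"
      define a where "a = arg_min_on h A"
      have a: "a \<in> A" "\<And>b. b \<in> A \<Longrightarrow> h a \<le> h b"
        unfolding a_def using arg_min_if_finite(1)[OF less.prems(1) False]
          arg_min_least[OF less.prems(1) False] by auto
      have zero: "b i = 0" if "b \<in> A" "i \<ge> N" for b i
        using that less.prems(2) X(2) unfolding grid_cells_def by fastforce
      have up: "b \<in> A - {a}" if "c \<in> A - {a}" "b \<in> fst ` X" "\<And>i. c i \<le> b i" for b c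
      proof -
        have "b \<in> A" using less.prems(3)[of c b] that by blast
        moreover have "b \<noteq> a"
        proof
          assume "b = a"
          have "h c = h b" using a(2)[of c] that(1,3) sum_mono[of "{..<N}" c b] \<open>b = a\<close>
            unfolding h_def by force
          then have "c i = b i" if "i < N" for i
            using sum_mono_inv[of c "{..<N}" b i] \<open>\<And>i. c i \<le> b i\<close> that unfolding h_def by simp
          then have "c = b" using zero that(1) \<open>b \<in> A\<close> by (metis DiffD1 ext not_less)
          then show False using that(1) \<open>b = a\<close> by blast
        qed
        ultimately show ?thesis by blast
      qed
      let ?K = "{\<sigma> \<in> X. fst \<sigma> \<in> A - {a}}"
      have eq: "{\<sigma> \<in> X. fst \<sigma> \<in> A} = ?K \<union> Pair a ` {S. (a, S) \<in> X}"
        using a(1) by (auto simp: image_iff)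
      have "card (A - {a}) < card A" using a(1) less.prems(1) by (intro psubset_card_mono) auto
      then have "vanishing j ?K"
        using less.prems(1,2) up by (intro less.hyps) blast+
      then show ?thesis
        unfolding eq
      proof (rule step[rotated -1])
        show "subcomplex ?K" by (rule sub) (rule up)
        show "subcomplex (?K \<union> Pair a ` {S. (a, S) \<in> X})"
          unfolding eq[symmetric] by (rule sub) (rule less.prems(3))
      qed (use a(1) less.prems(2) in auto)
    qed
  qed
  from this[of "fst ` X"] have "vanishing j {\<sigma> \<in> X. fst \<sigma> \<in> fst ` X}"
    using finX by blast
  moreover have "{\<sigma> \<in> X. fst \<sigma> \<in> fst ` X} = X" by auto
  ultimately show ?thesis by (simp only:)
qed

section \<open>The cubical complex of a configuration space\<close>

text \<open>A strict inequality of integers means a gap of at least 1. One and the same axis and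
  order must separate the two squares at all points of the cube.\<close>

definition separated :: "(nat \<Rightarrow> nat) \<Rightarrow> nat set \<Rightarrow> nat \<Rightarrow> nat \<Rightarrow> bool" where
  "separated a S k l \<longleftrightarrow>
     a (2 * k) + of_bool (2 * k \<in> S) < a (2 * l) \<or> a (2 * l) + of_bool (2 * l \<in> S) < a (2 * k) \<or>
     a (2 * k + 1) + of_bool (2 * k + 1 \<in> S) < a (2 * l + 1) \<or>
     a (2 * l + 1) + of_bool (2 * l + 1 \<in> S) < a (2 * k + 1)"

definition in_rectangle :: "nat \<Rightarrow> nat \<Rightarrow> (nat \<Rightarrow> nat) \<Rightarrow> nat set \<Rightarrow> nat \<Rightarrow> bool" where
  "in_rectangle p q a S k \<longleftrightarrow> 1 \<le> a (2 * k) \<and> a (2 * k) + of_bool (2 * k \<in> S) \<le> p \<and>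
     1 \<le> a (2 * k + 1) \<and> a (2 * k + 1) + of_bool (2 * k + 1 \<in> S) \<le> q"

definition config_cells :: "nat \<Rightarrow> nat \<Rightarrow> nat \<Rightarrow> cell set" where
  "config_cells n p q = {(a, S). (\<forall>i\<ge>2 * n. a i = 0 \<and> i \<notin> S) \<and>
     (\<forall>k<n. in_rectangle p q a S k) \<and> (\<forall>k<n. \<forall>l<n. k \<noteq> l \<longrightarrow> separated a S k l)}"

lemma subcomplex_config_cells: "subcomplex (config_cells n p q)"
  unfolding subcomplex_def
proof (intro ballI allI impI)
  fix \<sigma> \<tau> assume \<sigma>: "\<sigma> \<in> config_cells n p q" and f: "face \<tau> \<sigma>"
  obtain a S b R where eq: "\<sigma> = (a, S)" "\<tau> = (b, R)" by fastforce
  have pw: "a i \<le> b i" "b i + of_bool (i \<in> R) \<le> a i + of_bool (i \<in> S)" for i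
    using f unfolding eq face_def fst_conv snd_conv by blast+
  have \<sigma>': "\<And>i. i \<ge> 2 * n \<Longrightarrow> a i = 0 \<and> i \<notin> S" "\<And>k. k < n \<Longrightarrow> in_rectangle p q a S k"
    "\<And>k l. k < n \<Longrightarrow> l < n \<Longrightarrow> k \<noteq> l \<Longrightarrow> separated a S k l"
    using \<sigma> unfolding eq config_cells_def by blast+
  have "b i = 0 \<and> i \<notin> R" if "i \<ge> 2 * n" for i
    using \<sigma>'(1)[OF that] pw(2)[of i] by (cases "i \<in> R") auto
  moreover have "in_rectangle p q b R k" if "k < n" for k
    using \<sigma>'(2)[OF that] pw[of "2 * k"] pw[of "2 * k + 1"] unfolding in_rectangle_def by linarith
  moreover have "separated b R k l" if "k < n" "l < n" "k \<noteq> l" for k l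
    using \<sigma>'(3)[OF that] pw[of "2 * k"] pw[of "2 * k + 1"] pw[of "2 * l"] pw[of "2 * l + 1"]
    unfolding separated_def by linarith
  ultimately show "\<tau> \<in> config_cells n p q" unfolding eq config_cells_def by blast
qed

lemma config_cells_subset_grid: "config_cells n p q \<subseteq> grid_cells (2 * n) (p + q + 3)"
proof
  fix \<sigma> assume \<sigma>: "\<sigma> \<in> config_cells n p q"
  obtain a S where eq: "\<sigma> = (a, S)" by fastforce
  have \<sigma>': "\<And>i. i \<ge> 2 * n \<Longrightarrow> a i = 0 \<and> i \<notin> S" "\<And>k. k < n \<Longrightarrow> in_rectangle p q a S k"
    using \<sigma> unfolding eq config_cells_def by blast+
  have "a i + of_bool (i \<in> S) + 3 \<le> p + q + 3" for i
  proof (cases "i < 2 * n")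
    case True
    then have "i div 2 < n" by simp
    moreover have "i = 2 * (i div 2) \<or> i = 2 * (i div 2) + 1" by presburger
    ultimately show ?thesis using \<sigma>'(2)[of "i div 2"] unfolding in_rectangle_def by fastforce
  qed (use \<sigma>'(1)[of i] in auto)
  then show "\<sigma> \<in> grid_cells (2 * n) (p + q + 3)"
    using \<sigma>'(1) unfolding eq grid_cells_def by simp
qed

section \<open>Deforming the configuration space into its cubical subcomplex\<close>

definition config_set :: "nat \<Rightarrow> nat \<Rightarrow> nat \<Rightarrow> (nat \<Rightarrow> real) set" where
  "config_set n p q = {v. (\<forall>i\<ge>2 * n. v i = 0) \<and>
     (\<forall>k<n. 1 \<le> v (2 * k) \<and> v (2 * k) \<le> real p \<and> 1 \<le> v (2 * k + 1) \<and> v (2 * k + 1) \<le> real q) \<and>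
     (\<forall>k l. k < l \<and> l < n \<longrightarrow>
        \<bar>v (2 * k) - v (2 * l)\<bar> \<ge> 1 \<or> \<bar>v (2 * k + 1) - v (2 * l + 1)\<bar> \<ge> 1)}"

lemma square_config_space_eq: "square_config_space n p q = top_of_set (config_set n p q)"
proof -
  have "config_set n p q = {x. \<forall>i\<ge>2 * n. x i = 0} \<inter> {v. (\<forall>k<n. 1 \<le> v (2 * k) \<and> v (2 * k) \<le> real p \<and>
                  1 \<le> v (2 * k + 1) \<and> v (2 * k + 1) \<le> real q) \<and>
           (\<forall>k l. k < l \<and> l < n \<longrightarrow>
                  \<bar>v (2 * k) - v (2 * l)\<bar> \<ge> 1 \<or> \<bar>v (2 * k + 1) - v (2 * l + 1)\<bar> \<ge> 1)}"
    unfolding config_set_def by blast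
  then show ?thesis
    unfolding square_config_space_def Euclidean_space_def subtopology_subtopology euclidean_product_topology
    by simp
qed

lemma realization_config_cells_subset: "realization (config_cells n p q) \<subseteq> config_set n p q"
proof
  fix x assume "x \<in> realization (config_cells n p q)"
  then obtain a S where *: "(a, S) \<in> config_cells n p q" "x \<in> cube (a, S)"
    unfolding realization_def by fastforce
  have \<sigma>: "\<And>i. i \<ge> 2 * n \<Longrightarrow> a i = 0 \<and> i \<notin> S" "\<And>k. k < n \<Longrightarrow> in_rectangle p q a S k"
    "\<And>k l. k < n \<Longrightarrow> l < n \<Longrightarrow> k \<noteq> l \<Longrightarrow> separated a S k l"
    using *(1) unfolding config_cells_def by blast+
  have x: "real (a i) \<le> x i" "x i \<le> real (a i + of_bool (i \<in> S))" for i
    using *(2) by (simp_all add: cube_def)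
  have sep: "1 \<le> x k - x l" if "a l + of_bool (l \<in> S) < a k" for k l
  proof -
    have "real (a l + of_bool (l \<in> S)) + 1 \<le> real (a k)" using that by linarith
    then show ?thesis using x[of k] x[of l] by linarith
  qed
  have "x i = 0" if "i \<ge> 2 * n" for i
    using \<sigma>(1)[OF that] x[of i] by simp
  moreover have "1 \<le> x (2 * k) \<and> x (2 * k) \<le> real p \<and> 1 \<le> x (2 * k + 1) \<and> x (2 * k + 1) \<le> real q"
    if "k < n" for k
    using \<sigma>(2)[OF that] x[of "2 * k"] x[of "2 * k + 1"] unfolding in_rectangle_def
    by (smt (verit) of_nat_1 of_nat_mono)
  moreover have "\<bar>x (2 * k) - x (2 * l)\<bar> \<ge> 1 \<or> \<bar>x (2 * k + 1) - x (2 * l + 1)\<bar> \<ge> 1" if "k < l" "l < n" for k l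
  proof -
    have "separated a S k l" using \<sigma>(3) that by simp
    then show ?thesis
      unfolding separated_def by (elim disjE) (drule sep, linarith)+
  qed
  ultimately show "x \<in> config_set n p q" unfolding config_set_def by blast
qed

text \<open>The left-hand side bounds the ceiling of \<open>y\<close>, the upper end of the interval
  that the carrier cell has in this coordinate.\<close>

lemma carrier_bound_iff:
  assumes "0 \<le> y"
  shows "nat \<lfloor>y\<rfloor> + of_bool (y \<notin> \<int>) \<le> m \<longleftrightarrow> y \<le> real m"
proof (cases "y \<in> \<int>")
  case True
  then show ?thesis using assms by (auto elim!: Ints_cases)
next
  case False
  then have "y \<noteq> real m" by auto
  moreover have "nat \<lfloor>y\<rfloor> < m \<longleftrightarrow> y < real m"
    using assms by (simp add: nat_less_iff floor_less_iff)
  ultimately show ?thesis using False by auto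
qed

text \<open>With \<open>m\<close> the ceiling of the smaller height, the larger one has reached
  \<open>m + 1\<close>. For \<open>m = i + 1\<close> the smaller coordinate has begun step
  \<open>i\<close>, which is the situation of \<open>staircase_separates\<close>; for
  \<open>m = 0\<close> it is enough that \<open>t' \<ge> 1\<close>.\<close>

lemma carrier_separated:
  assumes "0 \<le> t" "t + 1 \<le> t'" "t \<le> real P" "P + 3 \<le> M"
  shows "nat \<lfloor>staircase M t\<rfloor> + of_bool (staircase M t \<notin> \<int>) < nat \<lfloor>staircase M t'\<rfloor>"
proof -
  define m where "m = nat \<lfloor>staircase M t\<rfloor> + of_bool (staircase M t \<notin> \<int>)"
  have m1: "staircase M t \<le> real m"
    using carrier_bound_iff[OF staircase_nonneg, of M t m] by (simp add: m_def)
  have "real (m + 1) \<le> staircase M t'"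
  proof (cases m)
    case 0
    then show ?thesis using assms by (intro staircase_ge_nat) (auto intro: order_trans[of _ 1])
  next
    case (Suc i)
    have "\<not> staircase M t \<le> real i"
      unfolding carrier_bound_iff[OF staircase_nonneg, symmetric] using Suc by (simp add: m_def)
    then show ?thesis using staircase_separates[of i M t t' P] assms Suc by simp
  qed
  then have "m + 1 \<le> nat \<lfloor>staircase M t'\<rfloor>" by (simp add: le_nat_floor)
  then show ?thesis by (simp add: m_def)
qed

lemma snap_in_realization:
  assumes x: "x \<in> config_set n p q"
  shows "snap (p + q + 3) x \<in> realization (config_cells n p q)"
proof -
  define M where "M = p + q + 3"
  let ?\<sigma> = "carrier_cell (snap M x)"
  have zero: "\<And>i. i \<ge> 2 * n \<Longrightarrow> x i = 0"
    and rect: "\<And>k. k < n \<Longrightarrow> 1 \<le> x (2 * k) \<and> x (2 * k) \<le> real p \<and> 1 \<le> x (2 * k + 1) \<and> x (2 * k + 1) \<le> real q"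
    and sep: "\<And>k l. k < l \<Longrightarrow> l < n \<Longrightarrow>
        \<bar>x (2 * k) - x (2 * l)\<bar> \<ge> 1 \<or> \<bar>x (2 * k + 1) - x (2 * l + 1)\<bar> \<ge> 1"
    using x unfolding config_set_def by blast+
  obtain a S where eq: "?\<sigma> = (a, S)" by fastforce
  have a: "a = (\<lambda>i. nat \<lfloor>staircase M (x i)\<rfloor>)" and S: "S = {i. staircase M (x i) \<notin> \<int>}"
    using eq by (simp_all add: carrier_cell_def snap_def)
  have lower: "1 \<le> a i" if "1 \<le> x i" for i
  proof -
    have "real 1 \<le> staircase M (x i)"
      using that by (intro staircase_ge_nat) (auto simp: M_def intro: order_trans[of _ 1])
    then show ?thesis unfolding a using le_nat_floor by fastforce
  qed
  have upper: "a i + of_bool (i \<in> S) \<le> P" if "x i \<le> real P" "P \<le> p + q" for i P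
  proof -
    have "staircase M (x i) \<le> real P"
      using that by (intro staircase_le_nat) (auto simp: M_def intro: order_trans)
    then show ?thesis
      using carrier_bound_iff[OF staircase_nonneg, of M "x i" P] by (simp add: a S)
  qed
  have lt: "a i + of_bool (i \<in> S) < a k" if "x i + 1 \<le> x k" "1 \<le> x i" "x i \<le> real P" "P \<le> p + q" for i k P
    using carrier_separated[of "x i" "x k" P M] that by (simp add: a S M_def)
  have rectangle: "in_rectangle p q a S k" if "k < n" for k
    using rect[OF that] lower[of "2 * k"] lower[of "2 * k + 1"] upper[of "2 * k" p] upper[of "2 * k + 1" q]
    unfolding in_rectangle_def by simp
  have sep1: "separated a S k l" if "k < l" "l < n" for k l
  proof -
    have "k < n" using that by simp
    have "x (2 * k) + 1 \<le> x (2 * l) \<or> x (2 * l) + 1 \<le> x (2 * k) \<or>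
        x (2 * k + 1) + 1 \<le> x (2 * l + 1) \<or> x (2 * l + 1) + 1 \<le> x (2 * k + 1)"
      using sep[OF that] by linarith
    then show ?thesis
      unfolding separated_def
      using rect[OF \<open>k < n\<close>] rect[OF \<open>l < n\<close>] lt[of "2 * k" "2 * l" p] lt[of "2 * l" "2 * k" p]
         lt[of "2 * k + 1" "2 * l + 1" q] lt[of "2 * l + 1" "2 * k + 1" q] by force
  qed
  have "separated a S k l" if "k < n" "l < n" "k \<noteq> l" for k l
    using sep1[of k l] sep1[of l k] that unfolding separated_def by (metis linorder_neqE_nat)
  moreover have "a i = 0 \<and> i \<notin> S" if "i \<ge> 2 * n" for i
    using upper[of i 0] zero[OF that] by (cases "i \<in> S") auto
  ultimately have "?\<sigma> \<in> config_cells n p q"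
    using rectangle unfolding eq config_cells_def by blast
  moreover have "snap M x \<in> cube ?\<sigma>"
    by (rule in_cube_carrier_cell) (simp add: snap_def staircase_nonneg)
  ultimately show ?thesis unfolding realization_def M_def by blast
qed

text \<open>A gap of at least 1 between two coordinates survives \<open>snap\<close> with the same
  sign, so it persists along the segment joining the two configurations.\<close>

lemma snap_homotopic_id:
  "homotopic_with (\<lambda>_. True) (top_of_set (config_set n p q)) (top_of_set (config_set n p q)) id (snap (p + q + 3))"
proof (rule homotopic_with_linear_product)
  fix x t assume x: "x \<in> config_set n p q" and t: "(0::real) \<le> t" "t \<le> 1"
  define M where "M = p + q + 3"
  let ?z = "\<lambda>i. (1 - t) * id x i + t * snap M x i"
  have y: "snap M x \<in> config_set n p q"
    using snap_in_realization[OF x] realization_config_cells_subset unfolding M_def by blast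
  have conv: "r \<le> (1 - t) * u + t * w" if "r \<le> u" "r \<le> w" for r u w :: real
    using convex_bound_le[of "-u" "-r" "-w" "1 - t" t] that t by simp
  have conv': "(1 - t) * u + t * w \<le> r" if "u \<le> r" "w \<le> r" for r u w :: real
    using convex_bound_le[of u r w "1 - t" t] that t by simp
  have gap: "1 \<le> ?z k - ?z i" if "x i + 1 \<le> x k" "1 \<le> x i" "x i \<le> real P" "P \<le> p + q" for i k P
  proof -
    have "nat \<lfloor>staircase M (x i)\<rfloor> + of_bool (staircase M (x i) \<notin> \<int>) < nat \<lfloor>staircase M (x k)\<rfloor>"
      using that by (intro carrier_separated[of _ _ P]) (auto simp: M_def)
    then have le: "nat \<lfloor>staircase M (x i)\<rfloor> + of_bool (staircase M (x i) \<notin> \<int>) \<le> nat \<lfloor>staircase M (x k)\<rfloor> - 1"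
      and pos: "1 \<le> nat \<lfloor>staircase M (x k)\<rfloor>" by linarith+
    have "staircase M (x i) \<le> real (nat \<lfloor>staircase M (x k)\<rfloor> - 1)"
      using le carrier_bound_iff[OF staircase_nonneg] by blast
    also have "\<dots> = real (nat \<lfloor>staircase M (x k)\<rfloor>) - 1" using pos by simp
    also have "\<dots> \<le> staircase M (x k) - 1" using of_nat_floor[OF staircase_nonneg] by simp
    finally have "1 \<le> snap M x k - snap M x i" by (simp add: snap_def)
    then have "1 \<le> (1 - t) * (x k - x i) + t * (snap M x k - snap M x i)"
      using that by (intro conv) auto
    then show ?thesis by (simp add: algebra_simps)
  qed
  have rect: "\<And>k. k < n \<Longrightarrow> 1 \<le> x (2 * k) \<and> x (2 * k) \<le> real p \<and> 1 \<le> x (2 * k + 1) \<and> x (2 * k + 1) \<le> real q"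
    and sep: "\<And>k l. k < l \<Longrightarrow> l < n \<Longrightarrow>
        \<bar>x (2 * k) - x (2 * l)\<bar> \<ge> 1 \<or> \<bar>x (2 * k + 1) - x (2 * l + 1)\<bar> \<ge> 1"
    using x unfolding config_set_def by blast+
  have "\<bar>?z (2 * k) - ?z (2 * l)\<bar> \<ge> 1 \<or> \<bar>?z (2 * k + 1) - ?z (2 * l + 1)\<bar> \<ge> 1" if kl: "k < l" "l < n" for k l
  proof -
    have "k < n" using that by simp
    have "x (2 * k) + 1 \<le> x (2 * l) \<or> x (2 * l) + 1 \<le> x (2 * k) \<or>
        x (2 * k + 1) + 1 \<le> x (2 * l + 1) \<or> x (2 * l + 1) + 1 \<le> x (2 * k + 1)"
      using sep[OF kl] by linarith
    then show ?thesis
      using rect[OF \<open>k < n\<close>] rect[OF \<open>l < n\<close>] gap[of "2 * k" "2 * l" p] gap[of "2 * l" "2 * k" p]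
         gap[of "2 * k + 1" "2 * l + 1" q] gap[of "2 * l + 1" "2 * k + 1" q] by linarith
  qed
  moreover have "?z i = 0" if "i \<ge> 2 * n" for i
    using x y that by (simp add: config_set_def)
  moreover have "1 \<le> ?z (2 * k) \<and> ?z (2 * k) \<le> real p \<and> 1 \<le> ?z (2 * k + 1) \<and> ?z (2 * k + 1) \<le> real q"
    if "k < n" for k
    using x y that unfolding config_set_def id_apply mem_Collect_eq by (intro conjI conv conv') blast+
  ultimately show "(\<lambda>i. (1 - t) * id x i + t * snap (p + q + 3) x i) \<in> config_set n p q"
    unfolding config_set_def M_def[symmetric] mem_Collect_eq by blast
qed (auto intro: continuous_on_id continuous_on_snap)

lemma square_config_space_vanishing:
  assumes "vanishing j (config_cells n p q)"
  shows "trivial_group (homology_group (int j) (square_config_space n p q))"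
  unfolding square_config_space_eq
proof (rule trivial_homology_group_homotopic_factor[OF snap_homotopic_id])
  show "snap (p + q + 3) ` topspace (top_of_set (config_set n p q)) \<subseteq> realization (config_cells n p q)"
    using snap_in_realization by auto
  have "subtopology (top_of_set (config_set n p q)) (realization (config_cells n p q)) =
      top_of_set (realization (config_cells n p q))"
    using realization_config_cells_subset by (simp add: subtopology_subtopology inf_absorb2)
  then show "trivial_group (homology_group (int j)
      (subtopology (top_of_set (config_set n p q)) (realization (config_cells n p q))))"
    using assms by simp
qed

section \<open>Expanding squares from a fixed corner\<close>

declare Suc_double_not_eq_double [simp] double_not_eq_Suc_double [simp]

text \<open>Along each axis a collision means equal coordinates, or coordinates differing by 1 and
  bridged by a move of the lower square. So one move per axis is a sufficient witness, and since the
  squares are apart at the corner, at least one axis supplies a move.\<close>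

lemma not_separated_flag:
  assumes "separated a {} k l" "\<not> separated a S k l"
  shows "\<exists>i\<in>S. \<exists>i'\<in>S. \<not> separated a {i, i'} k l"
proof -
  define x y x' y' where xy: "x = a (2 * k)" "y = a (2 * k + 1)" "x' = a (2 * l)" "y' = a (2 * l + 1)"
  have X: "x = x' \<or> (2 * k \<in> S \<and> x' = x + 1) \<or> (2 * l \<in> S \<and> x = x' + 1)"
    using assms(2) unfolding separated_def xy by (auto simp: of_bool_def split: if_splits)
  have Y: "y = y' \<or> (2 * k + 1 \<in> S \<and> y' = y + 1) \<or> (2 * l + 1 \<in> S \<and> y = y' + 1)"
    using assms(2) unfolding separated_def xy by (auto simp: of_bool_def split: if_splits)
  have ne: "x \<noteq> x' \<or> y \<noteq> y'"
    using assms(1) unfolding separated_def xy by auto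
  have nsep: "\<not> separated a T k l"
    if "x = x' \<or> (2 * k \<in> T \<and> x' = x + 1) \<or> (2 * l \<in> T \<and> x = x' + 1)"
       "y = y' \<or> (2 * k + 1 \<in> T \<and> y' = y + 1) \<or> (2 * l + 1 \<in> T \<and> y = y' + 1)" for T
    using that unfolding separated_def xy by auto
  show ?thesis
    using X Y ne nsep by (smt (verit) insert_iff)
qed

text \<open>
  With the lowest corner fixed, direction \<open>2 * k\<close> stands for widening square \<open>k\<close> and
  direction \<open>2 * k + 1\<close> for heightening it. Such a move covers the cell \<open>target\<close>, and both
  moves together also cover the cell \<open>diagonal k\<close>.
\<close>

locale corner =
  fixes n p q :: nat and a :: "nat \<Rightarrow> nat"
  assumes corner: "(a, {}) \<in> config_cells n p q"
begin

definition directions :: "nat set" where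
  "directions = {i. (a, {i}) \<in> config_cells n p q}"

definition adj :: "nat \<Rightarrow> nat \<Rightarrow> bool" where
  "adj i k \<longleftrightarrow> i \<in> directions \<and> k \<in> directions \<and> i \<noteq> k \<and> (a, {i, k}) \<notin> config_cells n p q"

definition pos :: "nat \<Rightarrow> nat \<times> nat" where
  "pos k = (a (2 * k), a (2 * k + 1))"

definition target :: "nat \<Rightarrow> nat \<times> nat" where
  "target i = (if even i then (a i + 1, a (i + 1)) else (a (i - 1), a i + 1))"

definition diagonal :: "nat \<Rightarrow> nat \<times> nat" where
  "diagonal k = (a (2 * k) + 1, a (2 * k + 1) + 1)"

lemma target_double [simp]: "target (2 * k) = (a (2 * k) + 1, a (2 * k + 1))"
  "target (Suc (2 * k)) = (a (2 * k), a (2 * k + 1) + 1)"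
  by (simp_all add: target_def)

text \<open>The board cells charged to the moves in \<open>T\<close>. If both moves of a square are
  present and do not conflict, folds may remove them separately, so the square needs a second cell
  besides its position; the free diagonal cell serves.\<close>

definition nodes :: "nat set \<Rightarrow> (nat \<times> nat) set" where
  "nodes T = target ` T \<union> pos ` {k. 2 * k \<in> T \<or> 2 * k + 1 \<in> T} \<union>
     diagonal ` {k. 2 * k \<in> T \<and> 2 * k + 1 \<in> T \<and> diagonal k \<notin> pos ` {..<n}}"

text \<open>Conflicting moves have targets on a common antidiagonal; this is the order in which they
  follow each other along it.\<close>

definition potential :: "nat \<Rightarrow> int" where
  "potential i = (if even i then 2 * int (a i) + 1 else 2 * int (a (i - 1)))"

lemma potential_double [simp]: "potential (2 * k) = 2 * int (a (2 * k)) + 1"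
  "potential (Suc (2 * k)) = 2 * int (a (2 * k))"
  by (simp_all add: potential_def)

lemma config_cells_iff:
  "(a, S) \<in> config_cells n p q \<longleftrightarrow> S \<subseteq> {..<2 * n} \<and> (\<forall>k<n. in_rectangle p q a S k) \<and>
     (\<forall>k<n. \<forall>l<n. k \<noteq> l \<longrightarrow> separated a S k l)"
proof -
  have "a i = 0" if "i \<ge> 2 * n" for i
    using corner that unfolding config_cells_def by blast
  then show ?thesis unfolding config_cells_def by (auto simp: not_le[symmetric])
qed

lemma config_cells_subset: "(a, S) \<in> config_cells n p q \<Longrightarrow> R \<subseteq> S \<Longrightarrow> (a, R) \<in> config_cells n p q"
  by (rule subcomplexD[OF subcomplex_config_cells]) (auto simp: face_def)

lemma separated_empty: "k < n \<Longrightarrow> l < n \<Longrightarrow> k \<noteq> l \<Longrightarrow> separated a {} k l"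
  using corner unfolding config_cells_def by blast

lemma pos_inj: "k < n \<Longrightarrow> l < n \<Longrightarrow> pos k = pos l \<Longrightarrow> k = l"
  using separated_empty[of k l] unfolding separated_def pos_def by auto

lemma corner_in_rectangle: "k < n \<Longrightarrow> in_rectangle p q a {} k"
  using corner unfolding config_cells_iff by blast

lemma directionsD:
  assumes "i \<in> directions"
  shows "i < 2 * n" "k < n \<Longrightarrow> in_rectangle p q a {i} k"
    "k < n \<Longrightarrow> l < n \<Longrightarrow> k \<noteq> l \<Longrightarrow> separated a {i} k l"
  using assms unfolding directions_def config_cells_iff by auto

lemma finite_directions: "finite directions"
  by (rule finite_subset[of _ "{..<2 * n}"]) (use directionsD(1) in auto)

lemma in_rectangle_singletons:
  assumes "in_rectangle p q a {} k" "\<And>i. i \<in> S \<Longrightarrow> in_rectangle p q a {i} k"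
  shows "in_rectangle p q a S k"
  using assms(1) assms(2)[of "2 * k"] assms(2)[of "2 * k + 1"] unfolding in_rectangle_def
  by (auto simp: of_bool_def)

text \<open>Leaving the rectangle is caused by a single move and a collision by at most two, so sets
  of moves are admissible as soon as their pairs are.\<close>

lemma config_cells_eq_independent_sets: "{S. (a, S) \<in> config_cells n p q} = independent_sets adj directions"
proof (intro equalityI subsetI)
  fix S assume "S \<in> {S. (a, S) \<in> config_cells n p q}"
  then have S: "(a, S) \<in> config_cells n p q" by simp
  show "S \<in> independent_sets adj directions"
    unfolding independent_sets_def adj_def directions_def by (auto intro: config_cells_subset[OF S])
next
  fix S assume "S \<in> independent_sets adj directions"
  then have S: "S \<subseteq> directions" and pair: "\<And>i k. i \<in> S \<Longrightarrow> k \<in> S \<Longrightarrow> (a, {i, k}) \<in> config_cells n p q"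
    unfolding independent_sets_def adj_def directions_def by force+
  have "separated a S k l" if kl: "k < n" "l < n" "k \<noteq> l" for k l
  proof (rule ccontr)
    assume "\<not> separated a S k l"
    then obtain i i' where "i \<in> S" "i' \<in> S" "\<not> separated a {i, i'} k l"
      using not_separated_flag[OF separated_empty[OF kl]] by blast
    then show False using pair[of i i'] kl unfolding config_cells_iff by blast
  qed
  moreover have "in_rectangle p q a S k" if "k < n" for k
    using in_rectangle_singletons[OF corner_in_rectangle[OF that]] directionsD(2)[OF _ that] S by blast
  moreover have "S \<subseteq> {..<2 * n}" using S directionsD(1) by blast
  ultimately show "S \<in> {S. (a, S) \<in> config_cells n p q}"
    unfolding config_cells_iff by blast
qed

lemma direction_cases:
  assumes "i \<in> directions"
  obtains k where "k < n" "i = 2 * k" | k where "k < n" "i = Suc (2 * k)"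
proof -
  have "i div 2 < n" using directionsD(1)[OF assms] by simp
  moreover have "i = 2 * (i div 2) \<or> i = Suc (2 * (i div 2))" by presburger
  ultimately show ?thesis using that by metis
qed

lemma same_parity_cases:
  assumes "i \<in> directions" "k \<in> directions" "even i = even k"
  obtains x y where "x < n" "y < n" "i = 2 * x" "k = 2 * y"
  | x y where "x < n" "y < n" "i = Suc (2 * x)" "k = Suc (2 * y)"
proof (rule direction_cases[OF assms(1)])
  fix x assume x: "x < n" "i = 2 * x"
  then show thesis using direction_cases[OF assms(2)] assms(3) that(1) by (metis dvd_triv_left even_Suc)
next
  fix x assume x: "x < n" "i = Suc (2 * x)"
  then show thesis using direction_cases[OF assms(2)] assms(3) that(2) by (metis dvd_triv_left even_Suc)
qed

lemma target_free: "i \<in> directions \<Longrightarrow> target i \<notin> pos ` {..<n}"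
proof
  assume i: "i \<in> directions" and "target i \<in> pos ` {..<n}"
  then obtain l where l: "l < n" "target i = pos l" by auto
  show False
  proof (rule direction_cases[OF i])
    fix k assume k: "k < n" "i = 2 * k"
    then have "k \<noteq> l" using l by (auto simp: pos_def)
    then show False
      using directionsD(3)[OF i k(1) l(1)] l(2) k(2) by (auto simp: pos_def separated_def)
  next
    fix k assume k: "k < n" "i = Suc (2 * k)"
    then have "k \<noteq> l" using l by (auto simp: pos_def)
    then show False
      using directionsD(3)[OF i k(1) l(1)] l(2) k(2) by (auto simp: pos_def separated_def)
  qed
qed

section \<open>The conflict graph over a corner\<close>

lemma adj_iff_ordered:
  assumes "2 * k \<in> directions" "Suc (2 * l) \<in> directions"
  shows "adj (2 * k) (Suc (2 * l)) \<longleftrightarrow>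
    target (2 * k) = target (Suc (2 * l)) \<or> (k = l \<and> diagonal k \<in> pos ` {..<n})"
proof -
  let ?S = "{2 * k, Suc (2 * l)}"
  have kl: "k < n" "l < n" using directionsD(1)[OF assms(1)] directionsD(1)[OF assms(2)] by simp_all
  have rect: "in_rectangle p q a ?S m" if "m < n" for m
    using in_rectangle_singletons[OF corner_in_rectangle[OF that], of ?S] directionsD(2)[OF assms(1) that]
      directionsD(2)[OF assms(2) that] by blast
  have "adj (2 * k) (Suc (2 * l)) \<longleftrightarrow> (\<exists>r<n. \<exists>s<n. r \<noteq> s \<and> \<not> separated a ?S r s)"
    using assms rect kl unfolding adj_def config_cells_iff by auto
  also have "\<dots> \<longleftrightarrow> target (2 * k) = target (Suc (2 * l)) \<or> (k = l \<and> diagonal k \<in> pos ` {..<n})"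
  proof
    assume "\<exists>r<n. \<exists>s<n. r \<noteq> s \<and> \<not> separated a ?S r s"
    then obtain r s where rs: "r < n" "s < n" "r \<noteq> s" "\<not> separated a ?S r s" by blast
    have sym: "separated a T r s = separated a T s r" for T
      unfolding separated_def by auto
    have "separated a {2 * k} r s" "separated a {Suc (2 * l)} r s" "separated a {} r s"
      using directionsD(3)[OF assms(1) rs(1-3)] directionsD(3)[OF assms(2) rs(1-3)] separated_empty[OF rs(1-3)] by auto
    with rs(4) have *: "(k = r \<or> k = s) \<and> (l = r \<or> l = s)"
      unfolding separated_def by (auto simp: of_bool_def split: if_splits)
    have "target (2 * k) = target (Suc (2 * l)) \<or> (k = l \<and> (diagonal k = pos r \<or> diagonal k = pos s))"
      using * rs(3,4) \<open>separated a {2 * k} r s\<close> \<open>separated a {Suc (2 * l)} r s\<close>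
      unfolding separated_def diagonal_def pos_def by (auto simp: of_bool_def split: if_splits)
    then show "target (2 * k) = target (Suc (2 * l)) \<or> (k = l \<and> diagonal k \<in> pos ` {..<n})"
      using rs by auto
  next
    assume "target (2 * k) = target (Suc (2 * l)) \<or> (k = l \<and> diagonal k \<in> pos ` {..<n})"
    then show "\<exists>r<n. \<exists>s<n. r \<noteq> s \<and> \<not> separated a ?S r s"
    proof
      assume t: "target (2 * k) = target (Suc (2 * l))"
      then have "k \<noteq> l" by auto
      moreover have "\<not> separated a ?S k l" using t by (auto simp: separated_def)
      ultimately show ?thesis using kl by blast
    next
      assume "k = l \<and> diagonal k \<in> pos ` {..<n}"
      then obtain m where m: "m < n" "diagonal k = pos m" "k = l" by auto
      then have "k \<noteq> m" by (auto simp: diagonal_def pos_def)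
      moreover have "\<not> separated a ?S k m" using m by (auto simp: separated_def diagonal_def pos_def)
      ultimately show ?thesis using kl m by blast
    qed
  qed
  finally show ?thesis .
qed

lemma adj_sym: "adj i k \<Longrightarrow> adj k i"
  by (auto simp: adj_def insert_commute)

lemma adj_iff:
  assumes "i \<in> directions" "k \<in> directions" "i \<noteq> k"
  shows "adj i k \<longleftrightarrow> target i = target k \<or> (i div 2 = k div 2 \<and> diagonal (i div 2) \<in> pos ` {..<n})"
proof -
  \<comment> \<open>Two moves along the same axis never conflict: a collision involving only that
    axis is bridged by one of them alone.\<close>
  have same: "\<not> adj i k" if par: "even i = even k"
  proof
    assume "adj i k"
    then have "(a, {i, k}) \<notin> config_cells n p q" by (simp add: adj_def)
    have rect: "in_rectangle p q a {i, k} m" if "m < n" for m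
      using in_rectangle_singletons[OF corner_in_rectangle[OF that], of "{i, k}"] directionsD(2)[OF assms(1) that]
        directionsD(2)[OF assms(2) that] by blast
    have "separated a {i, k} r s" if rs: "r < n" "s < n" "r \<noteq> s" for r s
      by (rule same_parity_cases[OF assms(1,2) par];
          use directionsD(3)[OF assms(1) rs] directionsD(3)[OF assms(2) rs] separated_empty[OF rs] in
            \<open>auto simp: separated_def of_bool_def split: if_splits\<close>)
    then show False
      using \<open>adj i k\<close> rect directionsD(1)[OF assms(1)] directionsD(1)[OF assms(2)]
      unfolding adj_def config_cells_iff by auto
  qed
  show ?thesis
  proof (rule direction_cases[OF assms(1)]; rule direction_cases[OF assms(2)])
    fix r s assume "r < n" "i = 2 * r" "s < n" "k = 2 * s"
    then show ?thesis using same assms(3) pos_inj[of r s] by (auto simp: pos_def)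
  next
    fix r s assume "r < n" "i = 2 * r" "s < n" "k = Suc (2 * s)"
    then show ?thesis using adj_iff_ordered[of r s] assms by simp
  next
    fix r s assume "r < n" "i = Suc (2 * r)" "s < n" "k = 2 * s"
    then show ?thesis using adj_iff_ordered[of s r] assms adj_sym[of i k] adj_sym[of k i] by auto
  next
    fix r s assume "r < n" "i = Suc (2 * r)" "s < n" "k = Suc (2 * s)"
    then show ?thesis using same assms(3) pos_inj[of r s] by (auto simp: pos_def)
  qed
qed

lemma adjD: "adj i k \<Longrightarrow> i \<in> directions \<and> k \<in> directions \<and> i \<noteq> k"
  by (simp add: adj_def)

lemma target_inj:
  assumes "i \<in> directions" "k \<in> directions" "even i = even k" "target i = target k"
  shows "i = k"
  by (rule same_parity_cases[OF assms(1-3)]) (use assms(4) in \<open>auto simp: pos_def intro!: pos_inj\<close>)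


lemma adj_potential:
  assumes "adj i k" shows "\<bar>potential i - potential k\<bar> = 1"
proof -
  have ik: "i \<in> directions" "k \<in> directions" "i \<noteq> k" using adjD[OF assms] by auto
  then have *: "target i = target k \<or> i div 2 = k div 2" using adj_iff[OF ik] assms by blast
  show ?thesis
    by (rule direction_cases[OF ik(1)]; rule direction_cases[OF ik(2)])
       (use ik(3) * pos_inj in \<open>auto simp: pos_def\<close>)
qed

lemma even_potential: "i \<in> directions \<Longrightarrow> even (potential i) \<longleftrightarrow> odd i"
  by (simp add: potential_def)

lemma adj_odd:
  assumes "adj i k" shows "even i \<longleftrightarrow> odd k"
proof -
  have "odd (potential i - potential k)" using adj_potential[OF assms] by presburger
  then show ?thesis using even_potential adjD[OF assms] by auto
qed

text \<open>A neighbour of \<open>i\<close> either shares its target or is the other move of the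
  same square. Each kind occurs at most once, and the two kinds lie on opposite sides of
  \<open>i\<close> in the potential.\<close>

lemma adj_potential_inj:
  assumes "adj i k" "adj i l" "potential k = potential l" shows "k = l"
proof -
  have d: "i \<in> directions" "k \<in> directions" "i \<noteq> k" "l \<in> directions" "i \<noteq> l"
    using adjD assms(1,2) by blast+
  have par: "even k = even l" using adj_odd[OF assms(1)] adj_odd[OF assms(2)] by blast
  have 1: "target i = target k \<or> i div 2 = k div 2" using adj_iff[OF d(1-3)] assms(1) by blast
  have 2: "target i = target l \<or> i div 2 = l div 2" using adj_iff[OF d(1,4,5)] assms(2) by blast
  show ?thesis
  proof (cases "target i = target k \<and> target i = target l")
    case True
    then show ?thesis using target_inj[OF d(2,4) par] by metis
  next
    case False
    then show ?thesis
      using 1 2 assms(3) adj_odd[OF assms(1)]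
      by (rule_tac direction_cases[OF d(1)]; rule_tac same_parity_cases[OF d(2,4) par]) auto
  qed
qed

section \<open>Counting free cells, moves and board cells\<close>

lemma target_in_grid:
  assumes "i \<in> directions" shows "target i \<in> {1..p} \<times> {1..q}"
proof (rule direction_cases[OF assms])
  fix k assume "k < n" "i = 2 * k"
  then show ?thesis using directionsD(2)[OF assms, of k] by (auto simp: in_rectangle_def)
next
  fix k assume "k < n" "i = Suc (2 * k)"
  then show ?thesis using directionsD(2)[OF assms, of k] by (auto simp: in_rectangle_def)
qed

lemma pos_in_grid: "k < n \<Longrightarrow> pos k \<in> {1..p} \<times> {1..q}"
  using corner_in_rectangle[of k] by (auto simp: in_rectangle_def pos_def)

lemma diagonal_in_grid:
  assumes "2 * k \<in> directions" "Suc (2 * k) \<in> directions"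
  shows "diagonal k \<in> {1..p} \<times> {1..q}"
  using target_in_grid[OF assms(1)] target_in_grid[OF assms(2)] by (auto simp: diagonal_def)

text \<open>A move with this target would belong to a square sitting on the target of one of the two
  moves of square \<open>k\<close>, but such targets are free.\<close>

lemma diagonal_not_target:
  assumes "2 * k \<in> directions" "Suc (2 * k) \<in> directions" "i \<in> directions"
  shows "diagonal k \<noteq> target i"
proof
  assume eq: "diagonal k = target i"
  have "i div 2 < n" using directionsD(1)[OF assms(3)] by simp
  then have "target (Suc (2 * k)) \<noteq> pos (i div 2)" "target (2 * k) \<noteq> pos (i div 2)"
    using target_free[OF assms(1)] target_free[OF assms(2)] by auto
  then show False
    by (rule_tac direction_cases[OF assms(3)]) (use eq in \<open>auto simp: diagonal_def pos_def\<close>)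
qed

lemma diagonal_inj: "k < n \<Longrightarrow> l < n \<Longrightarrow> diagonal k = diagonal l \<Longrightarrow> k = l"
  using pos_inj[of k l] by (simp add: diagonal_def pos_def)

lemma card_targets: "card (target ` directions) + n \<le> p * q"
proof -
  have "inj_on pos {..<n}" by (rule inj_onI) (use pos_inj in auto)
  then have "card (pos ` {..<n}) = n" by (simp add: card_image)
  moreover have "target ` directions \<inter> pos ` {..<n} = {}" using target_free by blast
  ultimately have "card (target ` directions) + n = card (target ` directions \<union> pos ` {..<n})"
    using finite_directions by (subst card_Un_disjoint) simp_all
  also have "\<dots> \<le> card ({1..p} \<times> {1..q})"
  proof (rule card_mono)
    show "target ` directions \<union> pos ` {..<n} \<subseteq> {1..p} \<times> {1..q}"
      using target_in_grid pos_in_grid by blast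
  qed simp
  finally show ?thesis by simp
qed

lemma card_nodes: "card (nodes directions) \<le> p * q"
proof -
  have "nodes directions \<subseteq> {1..p} \<times> {1..q}"
    unfolding nodes_def
  proof (intro Un_least image_subsetI)
    fix k assume "k \<in> {k. 2 * k \<in> directions \<or> 2 * k + 1 \<in> directions}"
    then have "k < n" using directionsD(1) by fastforce
    then show "pos k \<in> {1..p} \<times> {1..q}" by (rule pos_in_grid)
  qed (use target_in_grid diagonal_in_grid in auto)
  then have "card (nodes directions) \<le> card ({1..p} \<times> {1..q})" by (intro card_mono) auto
  then show ?thesis by simp
qed

lemma card_directions: "card directions \<le> 2 * n"
proof -
  have "directions \<subseteq> {..<2 * n}" using directionsD(1) by blast
  from card_mono[OF _ this] show ?thesis by simp
qed

lemma adj_if_target_eq: "\<lbrakk>i \<in> directions; k \<in> directions; i \<noteq> k; target i = target k\<rbrakk> \<Longrightarrow> adj i k"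
  by (simp add: adj_iff)

text \<open>Other moves with the target of \<open>w\<close> conflict with \<open>w\<close>, so they
  leave together with it.\<close>

lemma targets_fold:
  assumes "T \<subseteq> directions" "w \<in> T"
  shows "target w \<notin> target ` (T - {u. u = w \<or> adj w u})"
  using assms adj_if_target_eq[of w] by auto

lemma card_targets_fold:
  assumes T: "T \<subseteq> directions" "w \<in> T"
  shows "card (target ` (T - {u. u = w \<or> adj w u})) + 1 \<le> card (target ` T)"
proof -
  have fin: "finite (target ` T)" using T(1) finite_directions finite_subset by blast
  have "target ` (T - {u. u = w \<or> adj w u}) \<subset> target ` T"
    using targets_fold[OF T] T(2) by blast
  from psubset_card_mono[OF fin this] show ?thesis by simp
qed

lemma card_fold:
  assumes T: "T \<subseteq> directions" "v \<in> T" "w \<in> T" "adj v w"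
  shows "card (T - {u. u = w \<or> adj w u}) + 2 \<le> card T"
proof -
  have fin: "finite T" using T(1) finite_directions finite_subset by blast
  have "v \<noteq> w" using adjD T(4) by blast
  have "card (T - {u. u = w \<or> adj w u}) \<le> card (T - {v, w})"
    using fin adj_sym[OF T(4)] by (intro card_mono) auto
  also have "\<dots> = card T - 2" using T(2,3) \<open>v \<noteq> w\<close> by (simp add: card_Diff_subset)
  also have "card T \<ge> card {v, w}" using T(2,3) fin by (intro card_mono) auto
  then have "card T \<ge> 2" using \<open>v \<noteq> w\<close> by simp
  ultimately show ?thesis by linarith
qed

text \<open>The cell that a square gives up when a fold removes one of its moves: the diagonal if
  the other move may survive and still uses the position, and the position otherwise.\<close>

definition end_node :: "nat set \<Rightarrow> nat \<Rightarrow> nat \<times> nat" where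
  "end_node T k = (if 2 * k \<in> T \<and> 2 * k + 1 \<in> T \<and> diagonal k \<notin> pos ` {..<n} then diagonal k else pos k)"

lemma end_node_in_nodes: "i \<in> T \<Longrightarrow> end_node T (i div 2) \<in> nodes T"
proof -
  assume i: "i \<in> T"
  have "i = 2 * (i div 2) \<or> i = 2 * (i div 2) + 1" by presburger
  then have "2 * (i div 2) \<in> T \<or> 2 * (i div 2) + 1 \<in> T" using i by metis
  then show ?thesis unfolding end_node_def nodes_def by auto
qed

lemma nodes_mono: "T' \<subseteq> T \<Longrightarrow> nodes T' \<subseteq> nodes T"
  unfolding nodes_def by blast

lemma end_node_not_target:
  assumes T: "T \<subseteq> directions" "i \<in> T" "u \<in> directions"
  shows "end_node T (i div 2) \<noteq> target u"
proof -
  have "i div 2 < n" using directionsD(1) T by fastforce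
  then have "pos (i div 2) \<noteq> target u" using target_free[OF T(3)] by force
  then show ?thesis
    using T(1) diagonal_not_target[OF _ _ T(3), of "i div 2"]
    unfolding end_node_def by (auto split: if_splits)
qed

text \<open>A diagonal is counted only while both moves are present, so it disappears with
  \<open>i\<close>. If the end node is the position, the other move of the square is absent from
  \<open>T\<close> or adjacent to \<open>i\<close>, and in the latter case \<open>partner\<close>
  removes it as well.\<close>

lemma end_node_removed:
  assumes T: "T \<subseteq> directions" "i \<in> T" and T': "T' \<subseteq> T" "i \<notin> T'"
    and partner: "\<And>i'. \<lbrakk>i' \<in> T; i' \<noteq> i; i' div 2 = i div 2; adj i i'\<rbrakk> \<Longrightarrow> i' \<notin> T'"
  shows "end_node T (i div 2) \<notin> nodes T'"
proof -
  define m where "m = i div 2"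
  have m: "m < n" using directionsD(1) T unfolding m_def by fastforce
  have i: "i = 2 * m \<or> i = Suc (2 * m)" unfolding m_def by presburger
  have lt: "k < n" if "2 * k \<in> T' \<or> Suc (2 * k) \<in> T'" for k
    using that T T' directionsD(1) by fastforce
  have dir: "u \<in> directions" if "u \<in> T'" for u using that T T' by blast
  have "end_node T m \<notin> target ` T'"
    using end_node_not_target[OF T dir] unfolding m_def by blast
  moreover have "end_node T m \<notin> pos ` {k. 2 * k \<in> T' \<or> 2 * k + 1 \<in> T'} \<union>
     diagonal ` {k. 2 * k \<in> T' \<and> 2 * k + 1 \<in> T' \<and> diagonal k \<notin> pos ` {..<n}}"
  proof (cases "2 * m \<in> T \<and> Suc (2 * m) \<in> T \<and> diagonal m \<notin> pos ` {..<n}")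
    case True
    then have "end_node T m = diagonal m" by (simp add: end_node_def)
    moreover have "diagonal m \<noteq> pos k" if "2 * k \<in> T' \<or> 2 * k + 1 \<in> T'" for k
      using True lt[of k] that by auto
    moreover have "diagonal m \<noteq> diagonal k" if "2 * k \<in> T'" "2 * k + 1 \<in> T'" for k
      using diagonal_inj[OF m, of k] lt[of k] that i T'(2) by auto
    ultimately show ?thesis by auto
  next
    case False
    then have e: "end_node T m = pos m" by (auto simp: end_node_def)
    have "2 * m \<notin> T' \<and> Suc (2 * m) \<notin> T'"
    proof (rule ccontr)
      assume "\<not> ?thesis"
      then obtain i' where i': "i' \<in> T'" "i' div 2 = m" "{i, i'} = {2 * m, Suc (2 * m)}"
        using i T'(2) by (auto simp: insert_commute)
      then have ne: "i' \<noteq> i" "i' \<in> T" using T' by auto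
      have "2 * m \<in> T \<and> Suc (2 * m) \<in> T" using i'(3) ne(2) T(2) by (metis insertCI insertE singletonD)
      then have "diagonal m \<in> pos ` {..<n}" using False by blast
      then have "adj i i'"
        using adj_iff[of i i'] ne i'(2) T unfolding m_def by auto
      then show False using partner[OF ne(2,1)] i'(1,2) unfolding m_def by blast
    qed
    then have "pos m \<notin> pos ` {k. 2 * k \<in> T' \<or> 2 * k + 1 \<in> T'}"
      using lt pos_inj[OF m] by auto
    moreover have "pos m \<in> pos ` {..<n}" using m by blast
    ultimately show ?thesis unfolding e by auto
  qed
  ultimately show ?thesis unfolding nodes_def m_def by blast
qed

lemma end_node_inj:
  assumes T: "T \<subseteq> directions" "i \<in> T" "k \<in> T" and eq: "end_node T (i div 2) = end_node T (k div 2)"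
  shows "i div 2 = k div 2"
proof -
  have "i div 2 < n" "k div 2 < n" using directionsD(1) T by fastforce+
  then have "pos (i div 2) \<in> pos ` {..<n}" "pos (k div 2) \<in> pos ` {..<n}"
    "pos (i div 2) = pos (k div 2) \<Longrightarrow> i div 2 = k div 2"
    "diagonal (i div 2) = diagonal (k div 2) \<Longrightarrow> i div 2 = k div 2"
    using pos_inj diagonal_inj by blast+
  then show ?thesis
    using eq unfolding end_node_def by (metis (no_types, lifting))
qed

lemma finite_nodes: "T \<subseteq> directions \<Longrightarrow> finite (nodes T)"
proof -
  assume T: "T \<subseteq> directions"
  then have "{k. 2 * k \<in> T \<or> 2 * k + 1 \<in> T} \<subseteq> {..<n}" using directionsD(1) by fastforce
  then have "finite {k. 2 * k \<in> T \<or> 2 * k + 1 \<in> T}" by (rule finite_subset) simp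
  moreover from this have "finite {k. 2 * k \<in> T \<and> 2 * k + 1 \<in> T \<and> diagonal k \<notin> pos ` {..<n}}"
    by (rule finite_subset[rotated]) auto
  ultimately show ?thesis
    using T finite_directions finite_subset unfolding nodes_def by blast
qed

text \<open>If \<open>v\<close> and \<open>w\<close> share a target, they belong to different
  squares, and the fold loses that target and both end nodes. Otherwise they are the two moves of
  one square, and it loses both targets and the end node of that square; the target of
  \<open>v\<close> goes because \<open>v\<close> is a leaf.\<close>

lemma card_nodes_fold:
  assumes T: "T \<subseteq> directions" "v \<in> T" "w \<in> T" "adj v w"
    and leaf: "\<And>u. u \<in> T \<Longrightarrow> adj v u \<Longrightarrow> u = w"
  shows "card (nodes (T - {u. u = w \<or> adj w u})) + 3 \<le> card (nodes T)"
proof -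
  let ?T' = "T - {u. u = w \<or> adj w u}"
  have vw: "v \<in> directions" "w \<in> directions" "v \<noteq> w" using adjD[OF T(4)] by auto
  have v': "v \<notin> ?T'" using adj_sym[OF T(4)] by simp
  have tnode: "target u \<in> nodes T" if "u \<in> T" for u
    using that unfolding nodes_def by blast
  have tnot: "target u \<notin> nodes ?T'" if u: "u \<in> directions" "target u \<notin> target ` ?T'" for u
  proof -
    have "target u \<noteq> pos k" if "2 * k \<in> ?T' \<or> 2 * k + 1 \<in> ?T'" for k
      using target_free[OF u(1)] directionsD(1)[of "2 * k"] directionsD(1)[of "2 * k + 1"] that T(1) by auto
    moreover have "target u \<noteq> diagonal k" if "2 * k \<in> ?T'" "2 * k + 1 \<in> ?T'" for k
      using diagonal_not_target[of k u] that T(1) u(1) by fastforce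
    ultimately show ?thesis using u(2) unfolding nodes_def by blast
  qed
  have tw: "target w \<notin> nodes ?T'" by (rule tnot[OF vw(2) targets_fold[OF T(1,3)]])
  have ev: "end_node T (v div 2) \<in> nodes T - nodes ?T'"
    using end_node_removed[OF T(1,2) _ v'] leaf end_node_in_nodes[OF T(2)] by blast
  have ew: "end_node T (w div 2) \<in> nodes T - nodes ?T'"
    using end_node_removed[OF T(1,3), of ?T'] end_node_in_nodes[OF T(3)] by blast
  have "\<exists>Q. Q \<subseteq> nodes T - nodes ?T' \<and> card Q = 3"
  proof (cases "target v = target w")
    case True
    then have "v div 2 \<noteq> w div 2"
      using vw(3) by (rule_tac direction_cases[OF vw(1)]; rule_tac direction_cases[OF vw(2)]) auto
    then have "card {target w, end_node T (v div 2), end_node T (w div 2)} = 3"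
      using end_node_inj[OF T(1-3)] end_node_not_target[OF T(1,2) vw(2)] end_node_not_target[OF T(1,3) vw(2)]
      by (metis card_3_iff)
    then show ?thesis using tw tnode[OF T(3)] ev ew by (intro exI[of _ "{target w, end_node T (v div 2), end_node T (w div 2)}"]) blast
  next
    case False
    have "target v \<notin> target ` ?T'"
    proof
      assume "target v \<in> target ` ?T'"
      then obtain u where u: "u \<in> ?T'" "target v = target u" by blast
      then have "adj v u" using adj_if_target_eq[OF vw(1)] T(1) v' by blast
      then show False using leaf u(1) by blast
    qed
    then have "target v \<notin> nodes ?T'" by (rule tnot[OF vw(1)])
    moreover have "card {target v, target w, end_node T (w div 2)} = 3"
      using False end_node_not_target[OF T(1,3) vw(2)] end_node_not_target[OF T(1,3) vw(1)] by (metis card_3_iff)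
    ultimately show ?thesis
      using tw tnode[OF T(3)] tnode[OF T(2)] ew by (intro exI[of _ "{target v, target w, end_node T (w div 2)}"]) blast
  qed
  then obtain Q where Q: "Q \<subseteq> nodes T - nodes ?T'" "card Q = 3" by blast
  have fin: "finite (nodes T)" by (rule finite_nodes[OF T(1)])
  have sub: "nodes ?T' \<subseteq> nodes T" by (intro nodes_mono) blast
  have "3 \<le> card (nodes T - nodes ?T')" using card_mono[OF _ Q(1)] fin Q(2) by simp
  also have "\<dots> = card (nodes T) - card (nodes ?T')" using sub fin by (intro card_Diff_subset) (auto intro: finite_subset)
  finally show ?thesis by linarith
qed

text \<open>The divisors 2 and 3 in the weights turn the loss of two moves or three board cells per
  fold into the unit decrease required of \<open>\<mu>\<close>.\<close>

lemma vanishing_Un_corner: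
  assumes j: "j + n > p * q \<or> j > n \<or> 3 * j > p * q"
    and K: "subcomplex K" "K \<subseteq> config_cells n p q" "subcomplex (K \<union> Pair a ` {S. (a, S) \<in> config_cells n p q})"
      "K \<inter> Pair a ` {S. (a, S) \<in> config_cells n p q} = {}" "vanishing j K"
  shows "vanishing j (K \<union> Pair a ` {S. (a, S) \<in> config_cells n p q})"
proof -
  have step: "vanishing j (K \<union> Pair a ` {S. (a, S) \<in> config_cells n p q})"
    if \<mu>: "\<And>T. 0 \<le> \<mu> T" "\<mu> directions < real j"
      "\<And>T v w. \<lbrakk>T \<subseteq> directions; v \<in> T; w \<in> T; adj v w; \<And>u. u \<in> T \<Longrightarrow> adj v u \<Longrightarrow> u = w\<rbrakk> \<Longrightarrow>
         \<mu> (T - {u. u = w \<or> adj w u}) + 1 \<le> \<mu> T" for \<mu>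
  proof -
    have eq: "{S. (a, S) \<in> config_cells n p q} = (\<union>) {} ` independent_sets adj directions"
      by (simp add: config_cells_eq_independent_sets)
    have grid: "K \<union> Pair a ` {S. (a, S) \<in> config_cells n p q} \<subseteq> grid_cells (2 * n) (p + q + 3)"
      using K(2) config_cells_subset_grid by blast
    show ?thesis
    proof (rule vanishing_Un_independent[of adj potential \<mu> directions directions "{}" j K a
          "2 * n" "p + q + 3", folded eq])
      show "\<mu> directions < real j - real (card {})" using \<mu>(2) by simp
    qed (fact adj_sym adj_potential adj_potential_inj \<mu>(1) \<mu>(3) finite_directions K grid
          order_refl Int_empty_left finite.emptyI)+
  qed
  from j consider "j + n > p * q" | "j > n" | "3 * j > p * q" by blast
  then show ?thesis
  proof cases
    case 1
    show ?thesis
    proof (rule step[of "\<lambda>T. real (card (target ` T))"])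
      show "real (card (target ` directions)) < real j" using 1 card_targets by linarith
      fix T v w assume T: "T \<subseteq> directions" "w \<in> T"
      show "real (card (target ` (T - {u. u = w \<or> adj w u}))) + 1 \<le> real (card (target ` T))"
        using card_targets_fold[OF T] by linarith
    qed simp
  next
    case 2
    show ?thesis
    proof (rule step[of "\<lambda>T. real (card T) / 2"])
      show "real (card directions) / 2 < real j" using 2 card_directions by linarith
      fix T v w assume T: "T \<subseteq> directions" "v \<in> T" "w \<in> T" "adj v w"
      show "real (card (T - {u. u = w \<or> adj w u})) / 2 + 1 \<le> real (card T) / 2"
        using card_fold[OF T] by linarith
    qed simp
  next
    case 3
    show ?thesis
    proof (rule step[of "\<lambda>T. real (card (nodes T)) / 3"])
      show "real (card (nodes directions)) / 3 < real j" using 3 card_nodes by linarith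
      fix T v w assume T: "T \<subseteq> directions" "v \<in> T" "w \<in> T" "adj v w" "\<And>u. u \<in> T \<Longrightarrow> adj v u \<Longrightarrow> u = w"
      show "real (card (nodes (T - {u. u = w \<or> adj w u}))) / 3 + 1 \<le> real (card (nodes T)) / 3"
        using card_nodes_fold[OF T] by linarith
    qed simp
  qed
qed

end

lemma config_cells_vanishing:
  assumes "j + n > p * q \<or> j > n \<or> 3 * j > p * q"
  shows "vanishing j (config_cells n p q)"
proof (rule vanishing_by_corners[OF subcomplex_config_cells config_cells_subset_grid])
  fix a K assume a: "a \<in> fst ` config_cells n p q"
    and K: "subcomplex K" "K \<subseteq> config_cells n p q" "subcomplex (K \<union> Pair a ` {S. (a, S) \<in> config_cells n p q})"
      "K \<inter> Pair a ` {S. (a, S) \<in> config_cells n p q} = {}" "vanishing j K"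
  from a obtain S where "(a, S) \<in> config_cells n p q" by force
  then have "(a, {}) \<in> config_cells n p q"
    by (rule subcomplexD[OF subcomplex_config_cells]) (simp add: face_def)
  then interpret corner n p q a by unfold_locales
  show "vanishing j (K \<union> Pair a ` {S. (a, S) \<in> config_cells n p q})"
    by (rule vanishing_Un_corner[OF assms K])
qed

theorem theorem1p1:
  fixes n p q j :: nat
  assumes "p \<ge> 1" and "q \<ge> 1" and "n \<le> p * q"
  shows "(int j > int (p * q) - int n \<longrightarrow>
            trivial_group (homology_group (int j) (square_config_space n p q))) \<and>
         (j > n \<longrightarrow>
            trivial_group (homology_group (int j) (square_config_space n p q))) \<and>
         (real j > real (p * q) / 3 \<longrightarrow>
            trivial_group (homology_group (int j) (square_config_space n p q))) \<and>
         (let x = real n / real (p * q); y = real j / real (p * q) in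
            \<not> trivial_group (homology_group (int j) (square_config_space n p q)) \<longrightarrow>
            y \<le> Min {1 - x, x, 1 / 3})"
proof -
  let ?H = "trivial_group (homology_group (int j) (square_config_space n p q))"
  have vanish: "?H" if "j + n > p * q \<or> j > n \<or> 3 * j > p * q"
    by (intro square_config_space_vanishing config_cells_vanishing that)
  have "real j / real (p * q) \<le> Min {1 - real n / real (p * q), real n / real (p * q), 1 / 3}" if "\<not> ?H"
  proof -
    have "j + n \<le> p * q" "j \<le> n" "3 * j \<le> p * q"
      using vanish that by (meson not_le)+
    then have *: "real j + real n \<le> real (p * q)" "real j \<le> real n" "3 * real j \<le> real (p * q)"
      by linarith+
    have "0 < real (p * q)" using assms(1,2) by simp
    then have "(real j + real n) / real (p * q) \<le> 1"
      "real j / real (p * q) \<le> real n / real (p * q)" "real j / real (p * q) \<le> 1 / 3"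
      using * by (simp_all only: divide_le_eq_1_pos divide_right_mono less_imp_le) (simp add: field_simps)
    then show ?thesis by (simp add: add_divide_distrib)
  qed
  moreover have "?H" if "int j > int (p * q) - int n" using vanish that by linarith
  moreover have "?H" if "j > n" using vanish that by blast
  moreover have "?H" if "real j > real (p * q) / 3"
  proof -
    have "real (3 * j) > real (p * q)" using that by simp
    then have "3 * j > p * q" by (simp only: of_nat_less_iff)
    then show ?thesis using vanish by blast
  qed
  ultimately show ?thesis unfolding Let_def by blast
qed

end
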